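(* Let $\mathcal{X}$ be a finite set, $G$ a finite commutative group, $\mathcal{O}$ the group of all functions $\mathcal{X}\to G$ under pointwise addition, and $\mathcal{A}\le\mathcal{O}$ a subgroup. Let $f$ be a group homomorphism from $\mathcal{A}$ into some group, with kernel $\mathcal{B}$, and let $|\mathcal{C}|=|\mathcal{A}|/|\mathcal{B}|$ be the order of the quotient $\mathcal{A}/\mathcal{B}$. Consider the problem: given $q$ quantum queries to an oracle $A$ drawn uniformly at random from $\mathcal{A}$, output $f(A)$. Then the maximum success probability of any quantum algorithm making $q$ queries for this problem is exactly \[P_{\mathcal{A},q,f}=\frac{1}{|\mathcal{C}|}\max_{e\in E_{\mathcal{A},q}}|E_{\mathcal{A},q,f,e}|=\frac{|\mathcal{B}|}{|\mathcal{A}|}\max_{e\in E_{\mathcal{A},q}}|E_{\mathcal{A},q,f,e}|.\]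
   Context: $\hat G$ denotes the group of characters of $G$ (homomorphisms $G\to\mathbb{C}^\times$). For $\mathbf{x}=(x_1,\dots,x_q)\in\mathcal{X}^q$ and $\boldsymbol\xi=(\xi_1,\dots,\xi_q)\in\hat G^q$, define the function $e_{\mathbf{x},\boldsymbol\xi}:\mathcal{A}\to\mathbb{C}^\times$ by $e_{\mathbf{x},\boldsymbol\xi}(A)=\prod_{i=1}^q\xi_i(A(x_i))$ (a character of $\mathcal{A}$). Let $E_{\mathcal{A},q}$ be the set of all such functions, where two pairs giving the same function on $\mathcal{A}$ are counted once. Define $e\equiv_f e'$ for $e,e'\in E_{\mathcal{A},q}$ if $e$ and $e'$ agree on $\mathcal{B}$, and let $E_{\mathcal{A},q,f,e}=\{e'\in E_{\mathcal{A},q}: e'\equiv_f e\}$. A quantum query to $A$ is the unitary $|x,g,z\rangle\mapsto|x,g+A(x),z\rangle$, equivalently (via the Fourier transform on $G$) the phase query $|x,\xi,z\rangle\mapsto\xi(A(x))|x,\xi,z\rangle$; algorithms may make queries sequentially and adaptively. Success probability is averaged over uniform $A\in\mathcal{A}$. *)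

theory Defs
  imports Complex_Main "HOL-Algebra.Product_Groups" "HOL-Algebra.Coset"
begin

section \<open>Characters\<close>

definition complex_mult_group :: "complex monoid" where
  "complex_mult_group = \<lparr>carrier = UNIV - {0}, monoid.mult = (*), one = 1\<rparr>"

definition characters :: "('g, 'm) monoid_scheme \<Rightarrow> ('g \<Rightarrow> complex) set" where
  "characters G = hom G complex_mult_group"

text \<open>
  The group of all functions \<open>X \<rightarrow> G\<close> is the library's \<open>product_group\<close> with constant factors;
  its elements are extensional (equal to \<open>undefined\<close> outside \<open>X\<close>).
\<close>

abbreviation fun_group :: "'x set \<Rightarrow> ('g, 'm) monoid_scheme \<Rightarrow> ('x \<Rightarrow> 'g) monoid" where
  "fun_group X G \<equiv> product_group X (\<lambda>_. G)"

abbreviation subgroup_as_group :: "('a, 'm) monoid_scheme \<Rightarrow> 'a set \<Rightarrow> ('a, 'm) monoid_scheme" where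
  "subgroup_as_group G S \<equiv> G\<lparr>carrier := S\<rparr>"

text \<open>
  The restriction to \<open>\<A>\<close> makes HOL equality of these functions coincide with equality on \<open>\<A>\<close>,
  so that pairs \<open>(x, \<xi>)\<close> inducing the same function on \<open>\<A>\<close> are identified.
\<close>

definition query_char ::
    "('x \<Rightarrow> 'g) set \<Rightarrow> nat \<Rightarrow> (nat \<Rightarrow> 'x) \<Rightarrow> (nat \<Rightarrow> 'g \<Rightarrow> complex) \<Rightarrow> ('x \<Rightarrow> 'g) \<Rightarrow> complex" where
  "query_char \<A> q x \<xi> = (\<lambda>A\<in>\<A>. \<Prod>i<q. \<xi> i (A (x i)))"

definition query_chars ::
    "'x set \<Rightarrow> ('g, 'm) monoid_scheme \<Rightarrow> ('x \<Rightarrow> 'g) set \<Rightarrow> nat \<Rightarrow> (('x \<Rightarrow> 'g) \<Rightarrow> complex) set" where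
  "query_chars X G \<A> q =
     {query_char \<A> q x \<xi> | x \<xi>. (\<forall>i<q. x i \<in> X) \<and> (\<forall>i<q. \<xi> i \<in> characters G)}"

definition query_char_class ::
    "'x set \<Rightarrow> ('g, 'm) monoid_scheme \<Rightarrow> ('x \<Rightarrow> 'g) set \<Rightarrow> nat \<Rightarrow> ('x \<Rightarrow> 'g) set
       \<Rightarrow> (('x \<Rightarrow> 'g) \<Rightarrow> complex) \<Rightarrow> (('x \<Rightarrow> 'g) \<Rightarrow> complex) set" where
  "query_char_class X G \<A> q \<B> e = {e' \<in> query_chars X G \<A> q. \<forall>B\<in>\<B>. e' B = e B}"

section \<open>Quantum query algorithms\<close>

text \<open>
  States and operators on the finite-dimensional Hilbert space with orthonormal basis \<open>S\<close>;
  amplitudes and matrix entries outside \<open>S\<close> are irrelevant.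
\<close>

type_synonym 'b state = "'b \<Rightarrow> complex"
type_synonym 'b op = "'b \<Rightarrow> 'b \<Rightarrow> complex"

definition apply_op :: "'b set \<Rightarrow> 'b op \<Rightarrow> 'b state \<Rightarrow> 'b state" where
  "apply_op S M \<psi> = (\<lambda>i. \<Sum>j\<in>S. M i j * \<psi> j)"

definition braket :: "'b set \<Rightarrow> 'b state \<Rightarrow> 'b state \<Rightarrow> complex" where
  "braket S \<phi> \<psi> = (\<Sum>i\<in>S. cnj (\<phi> i) * \<psi> i)"

definition is_unit_state :: "'b set \<Rightarrow> 'b state \<Rightarrow> bool" where
  "is_unit_state S \<psi> \<longleftrightarrow> braket S \<psi> \<psi> = 1"

definition is_unitary :: "'b set \<Rightarrow> 'b op \<Rightarrow> bool" where
  "is_unitary S U \<longleftrightarrow>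
     (\<forall>i\<in>S. \<forall>j\<in>S. (\<Sum>k\<in>S. cnj (U k i) * U k j) = (if i = j then 1 else 0)) \<and>
     (\<forall>i\<in>S. \<forall>j\<in>S. (\<Sum>k\<in>S. U i k * cnj (U j k)) = (if i = j then 1 else 0))"

definition is_positive :: "'b set \<Rightarrow> 'b op \<Rightarrow> bool" where
  "is_positive S M \<longleftrightarrow>
     (\<forall>\<psi>. braket S \<psi> (apply_op S M \<psi>) \<in> \<real> \<and> 0 \<le> Re (braket S \<psi> (apply_op S M \<psi>)))"

definition is_povm :: "'b set \<Rightarrow> 'y set \<Rightarrow> ('y \<Rightarrow> 'b op) \<Rightarrow> bool" where
  "is_povm S Y E \<longleftrightarrow> finite Y \<and> (\<forall>y\<in>Y. is_positive S (E y)) \<and>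
     (\<forall>i\<in>S. \<forall>j\<in>S. (\<Sum>y\<in>Y. E y i j) = (if i = j then 1 else 0))"

text \<open>
  The basis \<open>|x, g, z\<rangle>\<close> of the query space, with a workspace register \<open>z\<close> of dimension \<open>d\<close>,
  and the unitary \<open>|x, g, z\<rangle> \<mapsto> |x, g + A(x), z\<rangle>\<close> given by its matrix.
\<close>

definition query_basis :: "'x set \<Rightarrow> ('g, 'm) monoid_scheme \<Rightarrow> nat \<Rightarrow> ('x \<times> 'g \<times> nat) set" where
  "query_basis X G d = X \<times> carrier G \<times> {..<d}"

definition query_op :: "('g, 'm) monoid_scheme \<Rightarrow> ('x \<Rightarrow> 'g) \<Rightarrow> ('x \<times> 'g \<times> nat) op" where
  "query_op G A = (\<lambda>b' (x, g, z). if b' = (x, g \<otimes>\<^bsub>G\<^esub> A x, z) then 1 else 0)"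

text \<open>
  An algorithm starts in \<open>init\<close>, applies \<open>gate 0\<close>, then alternates queries with
  \<open>gate 1, gate 2, \<dots>\<close>, and finally measures \<open>povm\<close>; the outcome is its output.
\<close>

record ('x, 'g, 'y) query_algorithm =
  work_dim :: nat
  init :: "('x \<times> 'g \<times> nat) state"
  gate :: "nat \<Rightarrow> ('x \<times> 'g \<times> nat) op"
  outcomes :: "'y set"
  povm :: "'y \<Rightarrow> ('x \<times> 'g \<times> nat) op"

definition valid_algorithm ::
    "'x set \<Rightarrow> ('g, 'm) monoid_scheme \<Rightarrow> nat \<Rightarrow> ('x, 'g, 'y) query_algorithm \<Rightarrow> bool" where
  "valid_algorithm X G q alg \<longleftrightarrow>
     (let S = query_basis X G (work_dim alg) in
        is_unit_state S (init alg) \<and> (\<forall>t\<le>q. is_unitary S (gate alg t)) \<and>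
        is_povm S (outcomes alg) (povm alg))"

fun run :: "'x set \<Rightarrow> ('g, 'm) monoid_scheme \<Rightarrow> ('x, 'g, 'y) query_algorithm \<Rightarrow> ('x \<Rightarrow> 'g)
              \<Rightarrow> nat \<Rightarrow> ('x \<times> 'g \<times> nat) state" where
  "run X G alg A 0 = apply_op (query_basis X G (work_dim alg)) (gate alg 0) (init alg)"
| "run X G alg A (Suc t) =
     apply_op (query_basis X G (work_dim alg)) (gate alg (Suc t))
       (apply_op (query_basis X G (work_dim alg)) (query_op G A) (run X G alg A t))"

definition output_prob ::
    "'x set \<Rightarrow> ('g, 'm) monoid_scheme \<Rightarrow> nat \<Rightarrow> ('x, 'g, 'y) query_algorithm
       \<Rightarrow> ('x \<Rightarrow> 'g) \<Rightarrow> 'y \<Rightarrow> real" where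
  "output_prob X G q alg A y =
     (let S = query_basis X G (work_dim alg); \<psi> = run X G alg A q in
        if y \<in> outcomes alg then Re (braket S \<psi> (apply_op S (povm alg y) \<psi>)) else 0)"

definition success_prob ::
    "'x set \<Rightarrow> ('g, 'm) monoid_scheme \<Rightarrow> ('x \<Rightarrow> 'g) set \<Rightarrow> (('x \<Rightarrow> 'g) \<Rightarrow> 'y) \<Rightarrow> nat
       \<Rightarrow> ('x, 'g, 'y) query_algorithm \<Rightarrow> real" where
  "success_prob X G \<A> f q alg = (\<Sum>A\<in>\<A>. output_prob X G q alg A (f A)) / real (card \<A>)"

definition is_max_success_prob ::
    "'x set \<Rightarrow> ('g, 'm) monoid_scheme \<Rightarrow> ('x \<Rightarrow> 'g) set \<Rightarrow> (('x \<Rightarrow> 'g) \<Rightarrow> 'y) \<Rightarrow> nat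
       \<Rightarrow> real \<Rightarrow> bool" where
  "is_max_success_prob X G \<A> f q P \<longleftrightarrow>
     (\<exists>alg. valid_algorithm X G q alg \<and> success_prob X G \<A> f q alg = P) \<and>
     (\<forall>alg. valid_algorithm X G q alg \<longrightarrow> success_prob X G \<A> f q alg \<le> P)"

end

theory Submission
  imports Defs "HOL-Algebra.Multiplicative_Group" "HOL-Combinatorics.Transposition"
begin

text \<open>
  Since the characters of \<open>G\<close> span all functions on \<open>G\<close>, the amplitudes of the state after
  \<open>q\<close> queries, as functions of the oracle \<open>A\<close>, lie in the span of the characters
  \<open>e \<in> E\<close>: \<open>\<psi>\<^sub>A = \<Sum> e(A) \<phi>\<^sub>e\<close>, and \<open>\<Sum> \<parallel>\<phi>\<^sub>e\<parallel>\<^sup>2 = 1\<close> by Parseval.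
  The effect measured for \<open>f(A)\<close> is constant on the cosets of \<open>\<B>\<close>, and averaging over a coset
  kills the cross terms between inequivalent characters. Within a class of size \<open>m\<close>
  the Cauchy-Schwarz inequality costs a factor \<open>m\<close>, and summing the effects over \<open>A\<close> gives
  at most \<open>\<bar>\<B>\<bar>\<close> times the identity.

  Conversely, a uniform superposition of the members of a largest class acquires the phases
  \<open>e(A)\<close>; the resulting states, suitably rescaled, form a tight frame whose associated
  measurement attains the bound.
\<close>

section \<open>Characters of finite abelian groups\<close>

text \<open>The obstacle in the upper bound is that an algorithm may interleave arbitrary gates with
  its queries and end with an arbitrary measurement. Only the dependence of the amplitudes on
  \<open>A\<close> is used: gates do not see the oracle, so the number of queries alone limits which
  characters can occur. Multiplying \<open>A\<close> by an element of \<B> keeps the right answer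
  and changes the component of e only by the value of e at that element, which is why restrictions
  to \<B> decide what interferes. The converse makes every estimate tight. Equal amplitudes within
  one class lose nothing in Cauchy-Schwarz. Oracles in one coset of \<B> yield the same state up to
  a global phase, so all of them support the same answer. Orthogonality of the k characters spreads
  the states evenly over a k-dimensional space, which fixes the weight k / |\<A>| of each
  projection; |\<B>| of these add up to the success probability.\<close>

lemma charactersD:
  assumes "\<chi> \<in> characters G"
  shows "\<And>x. x \<in> carrier G \<Longrightarrow> \<chi> x \<noteq> 0"
    and "\<And>x y. x \<in> carrier G \<Longrightarrow> y \<in> carrier G \<Longrightarrow> \<chi> (x \<otimes>\<^bsub>G\<^esub> y) = \<chi> x * \<chi> y"
  using assms by (auto simp: characters_def complex_mult_group_def hom_def)

lemma charactersI:
  assumes "\<And>x. x \<in> carrier G \<Longrightarrow> \<chi> x \<noteq> 0"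
    and "\<And>x y. x \<in> carrier G \<Longrightarrow> y \<in> carrier G \<Longrightarrow> \<chi> (x \<otimes>\<^bsub>G\<^esub> y) = \<chi> x * \<chi> y"
  shows "\<chi> \<in> characters G"
  using assms by (auto simp: characters_def complex_mult_group_def hom_def)

lemma one_in_characters: "(\<lambda>_. 1) \<in> characters G"
  by (rule charactersI) auto

context group
begin

lemma character_one:
  assumes "\<chi> \<in> characters G" shows "\<chi> \<one> = 1"
proof -
  have "\<chi> \<one> * \<chi> \<one> = \<chi> \<one>"
    using charactersD(2)[OF assms, of \<one> \<one>] by simp
  then show ?thesis using charactersD(1)[OF assms, of \<one>] by simp
qed

lemma character_pow:
  assumes "\<chi> \<in> characters G" "x \<in> carrier G" shows "\<chi> (x [^] (n::nat)) = \<chi> x ^ n"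
  by (induction n) (auto simp: character_one charactersD assms)

lemma character_pow_order:
  assumes "\<chi> \<in> characters G" "x \<in> carrier G" shows "\<chi> x ^ order G = 1"
  using character_pow[OF assms, of "order G"] pow_order_eq_1[OF assms(2)] character_one[OF assms(1)]
  by simp

lemma norm_character:
  assumes "finite (carrier G)" "\<chi> \<in> characters G" "x \<in> carrier G" shows "norm (\<chi> x) = 1"
proof -
  have "norm (\<chi> x) ^ order G = 1"
    using character_pow_order[OF assms(2,3)] by (simp add: norm_power[symmetric])
  moreover have "order G > 0" using assms(1) order_gt_0_iff_finite by blast
  ultimately show ?thesis
    using power_eq_imp_eq_base[of "norm (\<chi> x)" "order G" 1] by simp
qed

lemma character_mult_cnj:
  assumes "finite (carrier G)" "\<chi> \<in> characters G" "x \<in> carrier G"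
  shows "\<chi> x * cnj (\<chi> x) = 1" "cnj (\<chi> x) * \<chi> x = 1"
  using norm_character[OF assms] by (simp_all add: complex_norm_square[symmetric] mult.commute)

text \<open>The summand is again multiplicative. Translating by an element where it differs from 1
  multiplies the sum by that value, yet only reindexes it. Equality is tested on the carrier because
  characters are arbitrary elsewhere.\<close>

lemma character_orthogonality:
  assumes fin: "finite (carrier G)" and \<chi>: "\<chi> \<in> characters G" and \<chi>': "\<chi>' \<in> characters G"
  shows "(\<Sum>x\<in>carrier G. cnj (\<chi> x) * \<chi>' x) =
         (if \<forall>x\<in>carrier G. \<chi> x = \<chi>' x then of_nat (card (carrier G)) else 0)"
proof (cases "\<forall>x\<in>carrier G. \<chi> x = \<chi>' x")
  case True
  then have "(\<Sum>x\<in>carrier G. cnj (\<chi> x) * \<chi>' x) = (\<Sum>x\<in>carrier G. 1)"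
    using character_mult_cnj[OF fin \<chi>'] by (intro sum.cong) auto
  then show ?thesis using True by simp
next
  case False
  then obtain g where g: "g \<in> carrier G" "\<chi> g \<noteq> \<chi>' g" by blast
  let ?h = "\<lambda>x. cnj (\<chi> x) * \<chi>' x"
  have "?h g \<noteq> 1"
  proof
    assume "?h g = 1"
    then have "\<chi> g * (cnj (\<chi> g) * \<chi>' g) = \<chi> g" by simp
    then show False using g character_mult_cnj[OF fin \<chi> g(1)] by (simp add: mult.assoc[symmetric])
  qed
  moreover have "?h g * (\<Sum>x\<in>carrier G. ?h x) = (\<Sum>x\<in>carrier G. ?h x)"
  proof -
    have "?h g * (\<Sum>x\<in>carrier G. ?h x) = (\<Sum>x\<in>carrier G. ?h (g \<otimes> x))"
      using g(1) by (simp add: sum_distrib_left charactersD(2)[OF \<chi>] charactersD(2)[OF \<chi>'] mult_ac cong: sum.cong)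
    also have "\<dots> = (\<Sum>x\<in>carrier G. ?h x)"
      using g(1) by (intro sum.reindex_bij_betw bij_betw_imageI inj_on_cmult surj_const_mult)
    finally show ?thesis .
  qed
  ultimately have "(\<Sum>x\<in>carrier G. ?h x) = 0"
    by (simp only: mult_cancel_right2) simp
  then show ?thesis using False by auto
qed

end

section \<open>Roots of unity and separation of points by characters\<close>

lemma sum_powers_root_of_unity:
  fixes n j :: nat
  assumes "j < n"
  defines "w \<equiv> cis (2 * pi / real n)"
  shows "(\<Sum>k<n. w ^ (k * j)) = (if j = 0 then of_nat n else 0)"
proof (cases "j = 0")
  case False
  have pow: "w ^ m = cis (2 * pi * real m / real n)" for m
    unfolding w_def by (simp add: DeMoivre mult_ac)
  have "w ^ j \<noteq> 1"
  proof
    assume "w ^ j = 1"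
    then have "cis (2 * pi * real j / real n) = cis (2 * pi * real 0 / real n)" by (simp add: pow)
    moreover have "inj_on (\<lambda>k. cis (2 * pi * real k / real n)) {..<n}"
      using bij_betw_roots_unity[of n] assms(1) by (simp add: bij_betw_def)
    ultimately show False using inj_onD[of "\<lambda>k. cis (2 * pi * real k / real n)" "{..<n}" j 0] assms False by auto
  qed
  moreover have "(w ^ j) ^ n = 1"
  proof -
    have "w ^ n = 1" using assms(1) by (simp add: pow)
    then show ?thesis by (metis power_mult mult.commute power_one)
  qed
  ultimately have "(\<Sum>k<n. (w ^ j) ^ k) = 0" using geometric_sum[of "w ^ j" n] by simp
  then show ?thesis using False by (simp add: power_mult[symmetric] mult.commute)
qed auto

context comm_group
begin

text \<open>
  The average of \<open>F\<close> over the powers of \<open>a\<close>, twisted by an \<open>n\<close>-th root of unity, is an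
  eigenfunction of translation by \<open>a\<close>, and these averages sum up to \<open>F\<close>. Doing so for every
  \<open>a\<close> in turn produces a simultaneous eigenfunction of all translations, which is a
  multiple of a character.
\<close>

lemma exists_eigenfunction:
  fixes F :: "'a \<Rightarrow> complex"
  assumes fin: "finite (carrier G)" and "finite T" "T \<subseteq> carrier G"
    and g: "g \<in> carrier G" and F: "F g \<noteq> F \<one>"
  shows "\<exists>(F' :: 'a \<Rightarrow> complex) c. F' g \<noteq> F' \<one> \<and> (\<forall>a\<in>T. \<forall>x\<in>carrier G. F' (x \<otimes> a) = c a * F' x)"
  using assms(2,3)
proof (induction T rule: finite_induct)
  case empty
  then show ?case using F by auto
next
  case (insert a T)
  from insert.prems have "T \<subseteq> carrier G" by simp
  from insert.IH[OF this] obtain F' :: "'a \<Rightarrow> complex" and c where F': "F' g \<noteq> F' \<one>"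
    and eig: "\<And>b x. b \<in> T \<Longrightarrow> x \<in> carrier G \<Longrightarrow> F' (x \<otimes> b) = c b * F' x" by blast
  have a: "a \<in> carrier G" and T: "T \<subseteq> carrier G" using insert.prems by auto
  \<comment> \<open>The group order is a period of the powers of every element, so the same root of
    unity serves for each \<open>a\<close>.\<close>
  define n where "n = order G"
  have n: "n > 0" using fin order_gt_0_iff_finite n_def by blast
  define w where "w = cis (2 * pi / real n)"
  have wn: "w ^ n = 1" using n by (simp add: w_def DeMoivre)
  have w0: "w \<noteq> 0" by (simp add: w_def cis_neq_zero)
  define Fk where "Fk k x = (\<Sum>j<n. w ^ (k * j) * F' (x \<otimes> a [^] j))" for k x
  have sumFk: "(\<Sum>k<n. Fk k x) = of_nat n * F' x" if "x \<in> carrier G" for x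
  proof -
    have "(\<Sum>k<n. Fk k x) = (\<Sum>j<n. (\<Sum>k<n. w ^ (k * j)) * F' (x \<otimes> a [^] j))"
      unfolding Fk_def sum_distrib_right by (rule sum.swap)
    also have "\<dots> = (\<Sum>j<n. if j = 0 then of_nat n * F' (x \<otimes> a [^] j) else 0)"
      by (intro sum.cong) (auto simp: sum_powers_root_of_unity w_def)
    also have "\<dots> = of_nat n * F' (x \<otimes> a [^] (0::nat))"
      using n by (subst sum.delta) auto
    finally show ?thesis using that by simp
  qed
  \<comment> \<open>By \<open>sumFk\<close>, if no twisted average separated \<open>g\<close> from
    \<open>\<one>\<close>, neither would \<open>F'\<close>; one separating \<open>k\<close> is
    enough to continue the induction.\<close>
  have "\<exists>k. Fk k g \<noteq> Fk k \<one>"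
  proof (rule ccontr)
    assume "\<nexists>k. Fk k g \<noteq> Fk k \<one>"
    then have "(\<Sum>k<n. Fk k g) = (\<Sum>k<n. Fk k \<one>)" by simp
    then show False using F' n g by (simp add: sumFk)
  qed
  then obtain k where k: "Fk k g \<noteq> Fk k \<one>" by blast
  have eiga: "Fk k (x \<otimes> a) = inverse (w ^ k) * Fk k x" if x: "x \<in> carrier G" for x
  proof -
    define h where "h j = w ^ (k * j) * F' (x \<otimes> a [^] j)" for j
    have "h n = h 0"
      using a pow_order_eq_1[OF a] wn by (simp add: h_def n_def[symmetric] power_mult mult.commute[of k])
    then have "(\<Sum>j<n. h (Suc j)) = (\<Sum>j<n. h j)"
      using sum.lessThan_Suc_shift[of h n] sum.lessThan_Suc[of h n] by simp
    moreover have "w ^ k * Fk k (x \<otimes> a) = (\<Sum>j<n. h (Suc j))"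
      using x a unfolding Fk_def h_def sum_distrib_left
      by (intro sum.cong) (auto simp: power_add m_ac)
    ultimately show ?thesis using w0 by (simp add: Fk_def h_def field_simps)
  qed
  \<comment> \<open>Translations commute, so averaging along the powers of \<open>a\<close> keeps
    the eigenvalues already obtained.\<close>
  have eigb: "Fk k (x \<otimes> b) = c b * Fk k x" if "b \<in> T" and x: "x \<in> carrier G" for b x
  proof -
    have b: "b \<in> carrier G" using that T by auto
    have "F' (x \<otimes> b \<otimes> a [^] j) = c b * F' (x \<otimes> a [^] j)" for j :: nat
      using eig[OF that(1), of "x \<otimes> a [^] j"] x a b by (simp add: m_ac)
    then show ?thesis by (simp add: Fk_def sum_distrib_left mult_ac)
  qed
  show ?case
  proof (intro exI conjI ballI)
    show "Fk k g \<noteq> Fk k \<one>" by (rule k)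
    fix b x assume "b \<in> insert a T" "x \<in> carrier G"
    then show "Fk k (x \<otimes> b) = (if b = a then inverse (w ^ k) else c b) * Fk k x"
      using eiga eigb by auto
  qed
qed

text \<open>The eigenvalues of a common eigenfunction \<open>F\<close> of all translations form the
  character, since \<open>F a = c a * F \<one>\<close>. If \<open>F \<one>\<close> were 0,
  \<open>F\<close> would vanish on the carrier and could not separate \<open>g\<close>; the
  indicator of \<open>g\<close> starts the construction.\<close>

lemma characters_separate:
  assumes fin: "finite (carrier G)" and g: "g \<in> carrier G" "g \<noteq> \<one>"
  shows "\<exists>\<chi>\<in>characters G. \<chi> g \<noteq> 1"
proof -
  obtain F :: "'a \<Rightarrow> complex" and c where F: "F g \<noteq> F \<one>"
    and eig: "\<And>a x. a \<in> carrier G \<Longrightarrow> x \<in> carrier G \<Longrightarrow> F (x \<otimes> a) = c a * F x"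
    using exists_eigenfunction[OF fin fin subset_refl g(1), of "\<lambda>x. if x = g then 1 else 0"] g
    by auto
  have Fc: "F a = c a * F \<one>" if "a \<in> carrier G" for a using eig[OF that, of \<one>] that by simp
  have F1: "F \<one> \<noteq> 0" using F Fc[OF g(1)] by auto
  have mult: "c (x \<otimes> y) = c x * c y" if "x \<in> carrier G" "y \<in> carrier G" for x y
  proof -
    have "c (x \<otimes> y) * F \<one> = c x * c y * F \<one>"
      using eig[OF that(2,1)] Fc[OF that(1)] Fc[of "x \<otimes> y"] that by (simp add: mult_ac)
    then show ?thesis using F1 by simp
  qed
  have c1: "c \<one> = 1" using Fc[of \<one>] F1 by simp
  have "c \<in> characters G"
  proof (rule charactersI)
    fix x assume x: "x \<in> carrier G"
    have "c x * c (inv x) = 1" using mult[of x "inv x"] x c1 by simp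
    then show "c x \<noteq> 0" by auto
  qed (rule mult)
  moreover have "c g \<noteq> 1" using F Fc[OF g(1)] by auto
  ultimately show ?thesis by blast
qed

text \<open>
  Characters are unconstrained outside the carrier, so a finite family is obtained by restriction.
\<close>

lemma delta_eq_sum_characters:
  assumes fin: "finite (carrier G)"
  obtains \<Xi> where "finite \<Xi>" "\<Xi> \<noteq> {}" "\<Xi> \<subseteq> characters G"
    "\<And>g. g \<in> carrier G \<Longrightarrow> (\<Sum>\<xi>\<in>\<Xi>. \<xi> g) = (if g = \<one> then of_nat (card \<Xi>) else 0)"
proof -
  define \<Xi> where "\<Xi> = characters G \<inter> extensional (carrier G)"
  have restr: "restrict \<chi> (carrier G) \<in> \<Xi>" if "\<chi> \<in> characters G" for \<chi>
    unfolding \<Xi>_def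
    using charactersD[OF that] by (auto intro: charactersI)
  have n: "order G > 0" using fin order_gt_0_iff_finite by blast
  have "\<Xi> \<subseteq> carrier G \<rightarrow>\<^sub>E {z. z ^ order G = 1}"
    using character_pow_order by (auto simp: \<Xi>_def PiE_def)
  moreover have "finite (carrier G \<rightarrow>\<^sub>E {z::complex. z ^ order G = 1})"
    using fin n by (intro finite_PiE) (auto intro: finite_roots_unity)
  ultimately have finX: "finite \<Xi>" by (rule finite_subset)
  show thesis
  proof (rule that[of \<Xi>])
    show "finite \<Xi>" by fact
    show "\<Xi> \<noteq> {}" using restr[OF one_in_characters] by blast
    show "\<Xi> \<subseteq> characters G" by (auto simp: \<Xi>_def)
    fix g assume g: "g \<in> carrier G"
    show "(\<Sum>\<xi>\<in>\<Xi>. \<xi> g) = (if g = \<one> then of_nat (card \<Xi>) else 0)"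
    proof (cases "g = \<one>")
      case True
      then have "(\<Sum>\<xi>\<in>\<Xi>. \<xi> g) = (\<Sum>\<xi>\<in>\<Xi>. 1)"
        by (intro sum.cong) (auto simp: \<Xi>_def character_one)
      then show ?thesis using True by simp
    next
      case False
      obtain \<chi> where \<chi>: "\<chi> \<in> characters G" "\<chi> g \<noteq> 1" using characters_separate[OF fin g False] by blast
      \<comment> \<open>Multiplication by a character that is not 1 at \<open>g\<close> permutes
        \<open>\<Xi>\<close>, so it fixes the sum while scaling it by \<open>\<chi> g\<close>.
        Restricting the product keeps it in \<open>\<Xi>\<close>.\<close>
      define m where "m \<xi> = (\<lambda>x\<in>carrier G. \<chi> x * \<xi> x)" for \<xi>
      have mX: "m \<xi> \<in> \<Xi>" if "\<xi> \<in> \<Xi>" for \<xi>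
      proof -
        have \<xi>: "\<xi> \<in> characters G" using that by (simp add: \<Xi>_def)
        show ?thesis unfolding m_def
          using charactersD[OF \<chi>(1)] charactersD[OF \<xi>]
          by (intro restr charactersI) (auto simp: mult_ac)
      qed
      have inj: "inj_on m \<Xi>"
      proof (rule inj_onI)
        fix \<xi> \<eta> assume *: "\<xi> \<in> \<Xi>" "\<eta> \<in> \<Xi>" "m \<xi> = m \<eta>"
        show "\<xi> = \<eta>"
        proof (rule extensionalityI[of _ "carrier G"])
          fix x assume x: "x \<in> carrier G"
          show "\<xi> x = \<eta> x" using fun_cong[OF *(3), of x] x charactersD(1)[OF \<chi>(1)] by (simp add: m_def)
        qed (use * in \<open>auto simp: \<Xi>_def\<close>)
      qed
      have "m ` \<Xi> = \<Xi>" using mX inj finX by (intro endo_inj_surj) auto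
      then have "(\<Sum>\<xi>\<in>\<Xi>. \<xi> g) = (\<Sum>\<xi>\<in>\<Xi>. m \<xi> g)"
        using sum.reindex[OF inj, of "\<lambda>\<xi>. \<xi> g"] by simp
      also have "\<dots> = \<chi> g * (\<Sum>\<xi>\<in>\<Xi>. \<xi> g)" using g by (simp add: m_def sum_distrib_left)
      finally show ?thesis using \<chi>(2) False by (simp add: mult_cancel_right2)
    qed
  qed
qed

end

section \<open>Sesquilinear forms and unitary evolution\<close>

definition sform :: "'b set \<Rightarrow> 'b op \<Rightarrow> 'b state \<Rightarrow> 'b state \<Rightarrow> complex" where
  "sform S M \<phi> \<psi> = braket S \<phi> (apply_op S M \<psi>)"

lemma apply_op_cong:
  assumes "\<And>j. j \<in> S \<Longrightarrow> \<psi> j = \<psi>' j" shows "apply_op S M \<psi> = apply_op S M \<psi>'"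
  using assms by (auto simp: apply_op_def cong: sum.cong)

lemma braket_cong:
  assumes "\<And>j. j \<in> S \<Longrightarrow> \<phi> j = \<phi>' j" "\<And>j. j \<in> S \<Longrightarrow> \<psi> j = \<psi>' j"
  shows "braket S \<phi> \<psi> = braket S \<phi>' \<psi>'"
  using assms by (auto simp: braket_def cong: sum.cong)

lemma sform_cong:
  assumes "\<And>j. j \<in> S \<Longrightarrow> \<phi> j = \<phi>' j" "\<And>j. j \<in> S \<Longrightarrow> \<psi> j = \<psi>' j"
  shows "sform S M \<phi> \<psi> = sform S M \<phi>' \<psi>'"
  unfolding sform_def using assms by (metis apply_op_cong braket_cong)

lemma sform_eq: "sform S M \<phi> \<psi> = (\<Sum>i\<in>S. \<Sum>j\<in>S. cnj (\<phi> i) * M i j * \<psi> j)"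
  by (simp add: sform_def braket_def apply_op_def sum_distrib_left mult_ac)

lemma sform_sum:
  "sform S M (\<lambda>b. \<Sum>e\<in>E. c e * p e b) (\<lambda>b. \<Sum>e\<in>E'. c' e * p' e b) =
   (\<Sum>e\<in>E. \<Sum>e'\<in>E'. cnj (c e) * c' e' * sform S M (p e) (p' e'))"
proof -
  have "sform S M (\<lambda>b. \<Sum>e\<in>E. c e * p e b) (\<lambda>b. \<Sum>e\<in>E'. c' e * p' e b) =
     (\<Sum>i\<in>S. \<Sum>j\<in>S. \<Sum>e\<in>E. \<Sum>e'\<in>E'. cnj (c e) * c' e' * (cnj (p e i) * M i j * p' e' j))"
    unfolding sform_eq
    by (simp add: sum_distrib_left sum_distrib_right mult_ac)
  also have "\<dots> = (\<Sum>i\<in>S. \<Sum>e\<in>E. \<Sum>j\<in>S. \<Sum>e'\<in>E'. cnj (c e) * c' e' * (cnj (p e i) * M i j * p' e' j))"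
    by (rule sum.cong[OF refl]) (rule sum.swap)
  also have "\<dots> = (\<Sum>e\<in>E. \<Sum>i\<in>S. \<Sum>j\<in>S. \<Sum>e'\<in>E'. cnj (c e) * c' e' * (cnj (p e i) * M i j * p' e' j))"
    by (rule sum.swap)
  also have "\<dots> = (\<Sum>e\<in>E. \<Sum>i\<in>S. \<Sum>e'\<in>E'. \<Sum>j\<in>S. cnj (c e) * c' e' * (cnj (p e i) * M i j * p' e' j))"
    by (rule sum.cong[OF refl], rule sum.cong[OF refl], rule sum.swap)
  also have "\<dots> = (\<Sum>e\<in>E. \<Sum>e'\<in>E'. \<Sum>i\<in>S. \<Sum>j\<in>S. cnj (c e) * c' e' * (cnj (p e i) * M i j * p' e' j))"
    by (rule sum.cong[OF refl], rule sum.swap)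
  finally show ?thesis by (simp add: sform_eq sum_distrib_left)
qed

lemma sform_scale:
  "sform S M (\<lambda>b. c * \<phi> b) (\<lambda>b. c' * \<psi> b) = cnj c * c' * sform S M \<phi> \<psi>"
  by (simp add: sform_eq sum_distrib_left mult_ac)

lemma sform_diff:
  "sform S M (\<lambda>b. \<phi> b - \<psi> b) (\<lambda>b. \<phi> b - \<psi> b) =
   sform S M \<phi> \<phi> - sform S M \<phi> \<psi> - sform S M \<psi> \<phi> + sform S M \<psi> \<psi>"
  by (simp add: sform_eq algebra_simps sum.distrib sum_subtractf)

lemma is_positive_sform: "is_positive S M \<Longrightarrow> 0 \<le> Re (sform S M \<psi> \<psi>)"
  by (simp add: is_positive_def sform_def)

text \<open>Expand \<open>0 \<le> \<langle>u e - u e', M (u e - u e')\<rangle>\<close> and sum over all related pairs.\<close>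

lemma sform_related_pairs_le:
  assumes fin: "finite E" and pos: "is_positive S M" and sym: "\<And>e e'. R e e' \<longleftrightarrow> R e' e"
  shows "Re (\<Sum>e\<in>E. \<Sum>e'\<in>{e'\<in>E. R e e'}. sform S M (u e) (u e'))
         \<le> (\<Sum>e\<in>E. real (card {e'\<in>E. R e e'}) * Re (sform S M (u e) (u e)))"
proof -
  let ?s = "\<lambda>e e'. Re (sform S M (u e) (u e'))"
  let ?R = "\<lambda>e. {e'\<in>E. R e e'}"
  \<comment> \<open>Symmetry of \<open>R\<close> merges the two cross terms and the two diagonal
    terms, leaving a common factor 2.\<close>
  have swap: "(\<Sum>e\<in>E. \<Sum>e'\<in>?R e. h e e') = (\<Sum>e\<in>E. \<Sum>e'\<in>?R e. h e' e)" for h :: "_ \<Rightarrow> _ \<Rightarrow> real"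
    using sum.swap_restrict[OF fin fin, of h R] sym by auto
  have "0 \<le> (\<Sum>e\<in>E. \<Sum>e'\<in>?R e. Re (sform S M (\<lambda>b. u e b - u e' b) (\<lambda>b. u e b - u e' b)))"
    by (intro sum_nonneg is_positive_sform pos)
  also have "\<dots> = (\<Sum>e\<in>E. \<Sum>e'\<in>?R e. ?s e e) - (\<Sum>e\<in>E. \<Sum>e'\<in>?R e. ?s e e')
      - (\<Sum>e\<in>E. \<Sum>e'\<in>?R e. ?s e' e) + (\<Sum>e\<in>E. \<Sum>e'\<in>?R e. ?s e' e')"
    by (simp add: sform_diff sum.distrib sum_subtractf)
  also have "\<dots> = 2 * (\<Sum>e\<in>E. \<Sum>e'\<in>?R e. ?s e e) - 2 * (\<Sum>e\<in>E. \<Sum>e'\<in>?R e. ?s e e')"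
    using swap[of ?s] swap[of "\<lambda>e e'. ?s e e"] by simp
  finally show ?thesis by simp
qed

lemma braket_self: "braket S \<psi> \<psi> = of_real (\<Sum>i\<in>S. (cmod (\<psi> i))\<^sup>2)"
  by (simp add: braket_def complex_norm_square mult.commute del: of_real_power)

lemma braket_apply_unitary:
  assumes fin: "finite S" and U: "is_unitary S U"
  shows "braket S (apply_op S U \<phi>) (apply_op S U \<psi>) = braket S \<phi> \<psi>"
proof -
  have "braket S (apply_op S U \<phi>) (apply_op S U \<psi>)
      = (\<Sum>k\<in>S. \<Sum>i\<in>S. \<Sum>j\<in>S. cnj (U k i) * U k j * (cnj (\<phi> i) * \<psi> j))"
    unfolding braket_def apply_op_def cnj_sum sum_product by (simp add: mult_ac)
  also have "\<dots> = (\<Sum>i\<in>S. \<Sum>k\<in>S. \<Sum>j\<in>S. cnj (U k i) * U k j * (cnj (\<phi> i) * \<psi> j))"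
    by (rule sum.swap)
  also have "\<dots> = (\<Sum>i\<in>S. \<Sum>j\<in>S. \<Sum>k\<in>S. cnj (U k i) * U k j * (cnj (\<phi> i) * \<psi> j))"
    by (rule sum.cong[OF refl], rule sum.swap)
  also have "\<dots> = (\<Sum>i\<in>S. \<Sum>j\<in>S. (if i = j then 1 else 0) * (cnj (\<phi> i) * \<psi> j))"
    using U by (simp add: is_unitary_def sum_distrib_right[symmetric])
  also have "\<dots> = braket S \<phi> \<psi>"
    using fin by (simp add: braket_def if_distrib[of "\<lambda>x. x * _"] cong: if_cong)
  finally show ?thesis .
qed

section \<open>The query operator and conservation of the norm during a run\<close>

lemma finite_query_basis:
  "finite X \<Longrightarrow> finite (carrier G) \<Longrightarrow> finite (query_basis X G d)"
  by (simp add: query_basis_def)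

context group
begin

text \<open>The query moves basis vectors forward, so the new amplitude at a basis vector is the old
  one at its preimage.\<close>

lemma apply_query_op:
  assumes fin: "finite X" "finite (carrier G)" and b: "(x, g, z) \<in> query_basis X G d"
    and A: "A x \<in> carrier G"
  shows "apply_op (query_basis X G d) (query_op G A) \<psi> (x, g, z) = \<psi> (x, g \<otimes> inv (A x), z)"
proof -
  let ?S = "query_basis X G d"
  have g: "g \<in> carrier G" using b by (simp add: query_basis_def)
  have eq: "query_op G A (x, g, z) j = (if j = (x, g \<otimes> inv (A x), z) then 1 else 0)"
    if "j \<in> ?S" for j
  proof -
    obtain x' g' z' where j: "j = (x', g', z')" by (cases j)
    have g': "g' \<in> carrier G" using that j by (simp add: query_basis_def)
    have "(x, g, z) = (x', g' \<otimes> A x', z') \<longleftrightarrow> j = (x, g \<otimes> inv (A x), z)"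
      using g g' A j by (auto simp: m_assoc inv_solve_right)
    then show ?thesis by (simp add: query_op_def j)
  qed
  have "(x, g \<otimes> inv (A x), z) \<in> ?S" using b g A by (simp add: query_basis_def)
  moreover have "apply_op ?S (query_op G A) \<psi> (x, g, z) =
      (\<Sum>j\<in>?S. if j = (x, g \<otimes> inv (A x), z) then \<psi> j else 0)"
    unfolding apply_op_def by (intro sum.cong) (auto simp: eq)
  ultimately show ?thesis using finite_query_basis[OF fin, where d = d] by simp
qed

lemma braket_apply_query_op:
  fixes d :: nat
  assumes fin: "finite X" "finite (carrier G)" and A: "\<And>x. x \<in> X \<Longrightarrow> A x \<in> carrier G"
  defines "S \<equiv> query_basis X G d"
  shows "braket S (apply_op S (query_op G A) \<phi>) (apply_op S (query_op G A) \<psi>) = braket S \<phi> \<psi>"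
proof -
  let ?t = "\<lambda>(x, g, z). (x, g \<otimes> inv (A x), z)"
  have bij: "bij_betw ?t S S"
    by (rule bij_betwI[where g = "\<lambda>(x, g, z). (x, g \<otimes> A x, z)"])
       (auto simp: S_def query_basis_def A m_assoc)
  have "apply_op S (query_op G A) \<psi> b = \<psi> (?t b)" if "b \<in> S" for b \<psi>
    using that apply_query_op[OF fin, where d = d] A by (auto simp: S_def query_basis_def)
  then have "braket S (apply_op S (query_op G A) \<phi>) (apply_op S (query_op G A) \<psi>) =
      (\<Sum>b\<in>S. cnj (\<phi> (?t b)) * \<psi> (?t b))"
    by (simp add: braket_def)
  also have "\<dots> = braket S \<phi> \<psi>"
    unfolding braket_def using sum.reindex_bij_betw[OF bij, of "\<lambda>b. cnj (\<phi> b) * \<psi> b"] .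
  finally show ?thesis .
qed

lemma braket_run:
  assumes fin: "finite X" "finite (carrier G)" and A: "\<And>x. x \<in> X \<Longrightarrow> A x \<in> carrier G"
    and valid: "valid_algorithm X G q alg" and "t \<le> q"
  shows "braket (query_basis X G (work_dim alg)) (run X G alg A t) (run X G alg A t) = 1"
  using \<open>t \<le> q\<close>
proof (induction t)
  case 0
  then show ?case
    using valid braket_apply_unitary[OF finite_query_basis[OF fin]]
    by (simp add: valid_algorithm_def is_unit_state_def Let_def)
next
  case (Suc t)
  then show ?case
    using valid braket_apply_unitary[OF finite_query_basis[OF fin]]
      braket_apply_query_op[where A = A, OF fin A]
    by (simp add: valid_algorithm_def Let_def)
qed

end

section \<open>The upper bound\<close>

text \<open>\<open>X\<close> is nonempty because otherwise the Hilbert space is zero and contains no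
  unit state to start from.\<close>

locale oracle_problem =
  fixes X :: "'x set" and G :: "('g, 'm) monoid_scheme" and \<A> :: "('x \<Rightarrow> 'g) set"
    and H :: "('h, 'n) monoid_scheme" and f :: "('x \<Rightarrow> 'g) \<Rightarrow> 'h" and \<B> :: "('x \<Rightarrow> 'g) set"
  assumes finite_X: "finite X" and X_nonempty: "X \<noteq> {}"
    and comm_group_G: "comm_group G" and finite_G: "finite (carrier G)"
    and subgroup_A: "subgroup \<A> (fun_group X G)"
    and group_H: "group H" and hom_f: "f \<in> hom (subgroup_as_group (fun_group X G) \<A>) H"
    and B_eq: "\<B> = kernel (subgroup_as_group (fun_group X G) \<A>) H f"
begin

text \<open>Products of oracles stay folded, so that facts about characters of \<open>K\<close>
  apply to them; \<open>oracle_mult\<close> evaluates them at a point.\<close>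

declare mult_product_group [simp del]

abbreviation K where "K \<equiv> subgroup_as_group (fun_group X G) \<A>"
abbreviation L where "L \<equiv> subgroup_as_group (fun_group X G) \<B>"

lemma group_G: "group G"
  using comm_group_G by (simp add: comm_group_def)

lemma group_K: "group K"
  using subgroup_A group_G by (simp add: subgroup.subgroup_is_group)

lemma group_hom_f: "group_hom K H f"
  by (intro group_hom.intro group_K group_H) (simp add: group_hom_axioms_def hom_f)

lemma subgroup_B: "subgroup \<B> K"
  unfolding B_eq by (rule group_hom.subgroup_kernel[OF group_hom_f])

lemma B_subset: "\<B> \<subseteq> \<A>"
  using subgroup.subset[OF subgroup_B] by simp

lemma group_L: "group L"
  using subgroup.subgroup_is_group[OF subgroup_B group_K] by simp

lemma oracle_closed: "A \<in> \<A> \<Longrightarrow> x \<in> X \<Longrightarrow> A x \<in> carrier G"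
  using subgroup.subset[OF subgroup_A] by auto

lemma oracle_mult: "x \<in> X \<Longrightarrow> (A \<otimes>\<^bsub>K\<^esub> B) x = A x \<otimes>\<^bsub>G\<^esub> B x"
  by (simp add: mult_product_group)

lemma mult_closed_A: "A \<in> \<A> \<Longrightarrow> B \<in> \<A> \<Longrightarrow> A \<otimes>\<^bsub>K\<^esub> B \<in> \<A>"
  using monoid.m_closed[of K A B] group_K by (simp add: group_def)

lemma finite_A: "finite \<A>"
proof (rule finite_subset)
  show "\<A> \<subseteq> X \<rightarrow>\<^sub>E carrier G" using subgroup.subset[OF subgroup_A] by simp
qed (use finite_X finite_G in \<open>auto intro: finite_PiE\<close>)

lemma finite_B: "finite \<B>"
  using finite_A B_subset by (rule rev_finite_subset)

lemma A_nonempty: "\<A> \<noteq> {}" and B_nonempty: "\<B> \<noteq> {}"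
  using subgroup.one_closed[OF subgroup_A] subgroup.one_closed[OF subgroup_B] by auto

lemma card_A_pos: "card \<A> > 0" and card_B_pos: "card \<B> > 0"
  using finite_A finite_B A_nonempty B_nonempty by (simp_all add: card_gt_0_iff)

lemma f_mult_kernel: "A \<in> \<A> \<Longrightarrow> B \<in> \<B> \<Longrightarrow> f (A \<otimes>\<^bsub>K\<^esub> B) = f A"
  using hom_mult[OF hom_f, of A B] hom_in_carrier[OF hom_f, of A] group_H
  by (auto simp: B_eq kernel_def group_def monoid.r_one)

lemma f_eq_imp_kernel:
  assumes "A \<in> \<A>" "A' \<in> \<A>" "f A = f A'"
  shows "\<exists>B\<in>\<B>. A' = A \<otimes>\<^bsub>K\<^esub> B"
proof
  interpret K: group K by (rule group_K)
  interpret H: group H by (rule group_H)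
  interpret group_hom K H f by (rule group_hom_f)
  have A: "A \<in> carrier K" "A' \<in> carrier K" using assms by auto
  show "A' = A \<otimes>\<^bsub>K\<^esub> (inv\<^bsub>K\<^esub> A \<otimes>\<^bsub>K\<^esub> A')"
    using K.inv_solve_left[of A' A] K.m_assoc K.r_inv A by (metis K.inv_closed K.l_one)
  have "f (inv\<^bsub>K\<^esub> A \<otimes>\<^bsub>K\<^esub> A') = \<one>\<^bsub>H\<^esub>"
    using A assms(3) by (metis H.l_inv K.inv_closed hom_closed hom_inv hom_mult)
  then show "inv\<^bsub>K\<^esub> A \<otimes>\<^bsub>K\<^esub> A' \<in> \<B>"
    unfolding B_eq kernel_def using A K.m_closed K.inv_closed by blast
qed

lemma bij_mult_kernel:
  assumes "A \<in> \<A>" shows "bij_betw (\<lambda>B. A \<otimes>\<^bsub>K\<^esub> B) \<B> {A'\<in>\<A>. f A' = f A}"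
proof (rule bij_betw_imageI)
  interpret K: group K by (rule group_K)
  show "inj_on (\<lambda>B. A \<otimes>\<^bsub>K\<^esub> B) \<B>"
    using K.inj_on_cmult[of A] assms B_subset by (auto intro: inj_on_subset)
  show "(\<lambda>B. A \<otimes>\<^bsub>K\<^esub> B) ` \<B> = {A' \<in> \<A>. f A' = f A}"
    using assms f_eq_imp_kernel[OF assms] f_mult_kernel[OF assms] mult_closed_A[OF assms] B_subset
    by fastforce
qed

text \<open>An inequality, because an algorithm may announce outcomes outside the image of
  \<open>f\<close>, where the fibre is empty.\<close>

lemma card_fibre_le: "card {A\<in>\<A>. f A = y} \<le> card \<B>"
proof (cases "\<exists>A\<in>\<A>. f A = y")
  case True
  then show ?thesis using bij_betw_same_card[OF bij_mult_kernel] by force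
qed (metis (mono_tags, lifting) Collect_empty_eq card.empty le0)

lemma order_quotient: "real (order (K Mod \<B>)) = real (card \<A>) / real (card \<B>)"
proof -
  have "card (rcosets\<^bsub>K\<^esub> \<B>) * card \<B> = card \<A>"
    using group.lagrange[OF group_K subgroup_B] by (simp add: order_def)
  then have "real (card (rcosets\<^bsub>K\<^esub> \<B>)) * real (card \<B>) = real (card \<A>)"
    by (metis of_nat_mult)
  then show ?thesis using card_B_pos by (simp add: order_def FactGroup_def field_simps)
qed

section \<open>The characters induced by queries\<close>

lemma characters_K_imp_L: "e \<in> characters K \<Longrightarrow> e \<in> characters L"
  using B_subset by (auto simp: characters_def hom_def)

lemma query_char_in_characters:
  assumes "\<forall>i<q. x i \<in> X" "\<forall>i<q. \<xi> i \<in> characters G"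
  shows "query_char \<A> q x \<xi> \<in> characters K"
proof (rule charactersI)
  fix A assume "A \<in> carrier K"
  then show "query_char \<A> q x \<xi> A \<noteq> 0"
    using assms by (auto simp: query_char_def charactersD(1) oracle_closed)
next
  fix A B assume AB: "A \<in> carrier K" "B \<in> carrier K"
  have "\<xi> i ((A \<otimes>\<^bsub>K\<^esub> B) (x i)) = \<xi> i (A (x i)) * \<xi> i (B (x i))" if "i < q" for i
    using that assms AB charactersD(2)[of "\<xi> i" G] by (simp add: oracle_closed oracle_mult[simplified])
  then show "query_char \<A> q x \<xi> (A \<otimes>\<^bsub>K\<^esub> B) = query_char \<A> q x \<xi> A * query_char \<A> q x \<xi> B"
    using AB mult_closed_A[of A B] by (simp add: query_char_def prod.distrib)
qed

lemma query_chars_subset: "query_chars X G \<A> q \<subseteq> characters K"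
  using query_char_in_characters by (auto simp: query_chars_def)

lemma query_chars_eqI:
  assumes "e \<in> query_chars X G \<A> q" "e' \<in> query_chars X G \<A> q" "\<And>A. A \<in> \<A> \<Longrightarrow> e A = e' A"
  shows "e = e'"
  using assms by (intro extensionalityI[of _ \<A>]) (auto simp: query_chars_def query_char_def)

text \<open>The pairs of query points and characters form no finite set, being arbitrary beyond
  index \<open>q\<close>. Finiteness comes from the functions themselves, whose values on \<A> are
  roots of unity.\<close>

lemma finite_query_chars: "finite (query_chars X G \<A> q)"
proof (rule finite_subset)
  have "e A ^ order K = 1" if "e \<in> query_chars X G \<A> q" "A \<in> \<A>" for e A
    using group.character_pow_order[OF group_K, of e A] query_chars_subset that by auto
  then show "query_chars X G \<A> q \<subseteq> \<A> \<rightarrow>\<^sub>E {z. z ^ order K = 1}"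
    by (auto simp: PiE_def query_chars_def query_char_def)
  have "order K > 0" using card_A_pos by (simp add: order_def)
  then show "finite (\<A> \<rightarrow>\<^sub>E {z::complex. z ^ order K = 1})"
    using finite_A by (intro finite_PiE) (auto intro: finite_roots_unity)
qed

lemma query_chars_0: "query_chars X G \<A> 0 = {\<lambda>A\<in>\<A>. 1}"
  by (auto simp: query_chars_def query_char_def)

lemma query_chars_nonempty: "query_chars X G \<A> q \<noteq> {}"
proof -
  obtain x where "x \<in> X" using X_nonempty by blast
  then have "query_char \<A> q (\<lambda>_. x) (\<lambda>_ _. 1) \<in> query_chars X G \<A> q"
    using one_in_characters by (auto simp: query_chars_def)
  then show ?thesis by blast
qed

lemma query_chars_Suc:
  assumes "e \<in> query_chars X G \<A> t" "x \<in> X" "\<xi> \<in> characters G"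
  shows "(\<lambda>A\<in>\<A>. \<xi> (A x) * e A) \<in> query_chars X G \<A> (Suc t)"
proof -
  obtain y \<eta> where e: "e = query_char \<A> t y \<eta>" "\<forall>i<t. y i \<in> X" "\<forall>i<t. \<eta> i \<in> characters G"
    using assms(1) by (auto simp: query_chars_def)
  have "(\<lambda>A\<in>\<A>. \<xi> (A x) * e A) = query_char \<A> (Suc t) (y(t := x)) (\<eta>(t := \<xi>))"
    by (auto simp: query_char_def e(1) restrict_def mult.commute fun_eq_iff)
  moreover have "\<forall>i<Suc t. (y(t := x)) i \<in> X" "\<forall>i<Suc t. (\<eta>(t := \<xi>)) i \<in> characters G"
    using assms(2,3) e(2,3) by (auto simp: less_Suc_eq)
  ultimately show ?thesis
    unfolding query_chars_def by blast
qed

text \<open>Plays the role of "degree at most \<open>t\<close>" in the polynomial method: stable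
  under linear combinations, and raised by one with each query.\<close>

definition in_query_span :: "nat \<Rightarrow> (('x \<Rightarrow> 'g) \<Rightarrow> complex) \<Rightarrow> bool" where
  "in_query_span t h \<longleftrightarrow> (\<exists>c. \<forall>A\<in>\<A>. h A = (\<Sum>e\<in>query_chars X G \<A> t. c e * e A))"

lemma in_query_span_char: "e \<in> query_chars X G \<A> t \<Longrightarrow> in_query_span t e"
  unfolding in_query_span_def
  by (rule exI[of _ "\<lambda>e'. if e' = e then 1 else 0"])
     (simp add: if_distrib[of "\<lambda>x. x * _"] finite_query_chars cong: if_cong)

lemma in_query_span_sum:
  assumes "\<And>i. i \<in> I \<Longrightarrow> in_query_span t (h i)"
  shows "in_query_span t (\<lambda>A. \<Sum>i\<in>I. c i * h i A)"
proof -
  from assms obtain d where d: "\<forall>i\<in>I. \<forall>A\<in>\<A>. h i A = (\<Sum>e\<in>query_chars X G \<A> t. d i e * e A)"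
    unfolding in_query_span_def by metis
  have "(\<Sum>i\<in>I. c i * h i A) = (\<Sum>e\<in>query_chars X G \<A> t. (\<Sum>i\<in>I. c i * d i e) * e A)"
    if "A \<in> \<A>" for A
  proof -
    have "(\<Sum>i\<in>I. c i * h i A) = (\<Sum>i\<in>I. \<Sum>e\<in>query_chars X G \<A> t. c i * d i e * e A)"
      using d that by (simp add: sum_distrib_left mult.assoc)
    also have "\<dots> = (\<Sum>e\<in>query_chars X G \<A> t. \<Sum>i\<in>I. c i * d i e * e A)"
      by (rule sum.swap)
    finally show ?thesis by (simp add: sum_distrib_right)
  qed
  then show ?thesis unfolding in_query_span_def
    by (intro exI[of _ "\<lambda>e. \<Sum>i\<in>I. c i * d i e"]) auto
qed

lemma in_query_span_cong:
  "in_query_span t h' \<Longrightarrow> (\<And>A. A \<in> \<A> \<Longrightarrow> h A = h' A) \<Longrightarrow> in_query_span t h"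
  by (simp add: in_query_span_def)

lemma in_query_span_Suc:
  assumes "in_query_span t h" "x \<in> X" "\<xi> \<in> characters G"
  shows "in_query_span (Suc t) (\<lambda>A. \<xi> (A x) * h A)"
proof -
  obtain c where c: "\<forall>A\<in>\<A>. h A = (\<Sum>e\<in>query_chars X G \<A> t. c e * e A)"
    using assms(1) by (auto simp: in_query_span_def)
  have "in_query_span (Suc t)
      (\<lambda>A. \<Sum>e\<in>query_chars X G \<A> t. c e * (\<lambda>A\<in>\<A>. \<xi> (A x) * e A) A)"
    using assms(2,3) by (intro in_query_span_sum in_query_span_char query_chars_Suc)
  moreover have "\<xi> (A x) * h A = (\<Sum>e\<in>query_chars X G \<A> t. c e * (\<lambda>A\<in>\<A>. \<xi> (A x) * e A) A)"
    if "A \<in> \<A>" for A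
    using c that by (simp add: sum_distrib_left mult_ac)
  ultimately show ?thesis by (rule in_query_span_cong)
qed

lemma in_query_span_apply_op:
  assumes "\<And>j. j \<in> S \<Longrightarrow> in_query_span t (\<lambda>A. \<psi> A j)"
  shows "in_query_span t (\<lambda>A. apply_op S M (\<psi> A) b)"
  unfolding apply_op_def using assms by (rule in_query_span_sum)

text \<open>
  Expanding the query matrix entry \<open>g = g' + A(x)\<close> into characters of \<open>G\<close> turns the query
  into a superposition of phase queries.
\<close>

lemma in_query_span_query:
  assumes span: "\<And>j. j \<in> query_basis X G d \<Longrightarrow> in_query_span t (\<lambda>A. \<psi> A j)"
    and b: "b \<in> query_basis X G d"
  shows "in_query_span (Suc t) (\<lambda>A. apply_op (query_basis X G d) (query_op G A) (\<psi> A) b)"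
proof -
  interpret G: comm_group G by (rule comm_group_G)
  obtain x g z where b': "b = (x, g, z)" by (cases b)
  have x: "x \<in> X" and g: "g \<in> carrier G" using b by (auto simp: b' query_basis_def)
  obtain \<Xi> where \<Xi>: "finite \<Xi>" "\<Xi> \<noteq> {}" "\<Xi> \<subseteq> characters G"
    and delta: "\<And>g. g \<in> carrier G \<Longrightarrow> (\<Sum>\<xi>\<in>\<Xi>. \<xi> g) = (if g = \<one>\<^bsub>G\<^esub> then of_nat (card \<Xi>) else 0)"
    using G.delta_eq_sum_characters[OF finite_G] by blast
  \<comment> \<open>The identity for \<open>\<Xi>\<close> will be evaluated at g' - g + A x (written
    additively), which is neutral exactly when g' is the preimage of g under the query.\<close>
  define c :: "'g \<times> ('g \<Rightarrow> complex) \<Rightarrow> complex" where "c = (\<lambda>(g', \<xi>). inverse (of_nat (card \<Xi>)) * \<xi> (g' \<otimes>\<^bsub>G\<^esub> inv\<^bsub>G\<^esub> g))"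
  have eq: "apply_op (query_basis X G d) (query_op G A) (\<psi> A) b =
      (\<Sum>p\<in>carrier G \<times> \<Xi>. c p * (snd p (A x) * \<psi> A (x, fst p, z)))" if A: "A \<in> \<A>" for A
  proof -
    have Ax: "A x \<in> carrier G" using oracle_closed[OF A x] .
    have inner: "(\<Sum>\<xi>\<in>\<Xi>. c (g', \<xi>) * (\<xi> (A x) * \<psi> A (x, g', z))) =
        (if g' = g \<otimes>\<^bsub>G\<^esub> inv\<^bsub>G\<^esub> A x then \<psi> A (x, g', z) else 0)" if g': "g' \<in> carrier G" for g'
    proof -
      have "g' \<otimes>\<^bsub>G\<^esub> inv\<^bsub>G\<^esub> g \<otimes>\<^bsub>G\<^esub> A x = \<one>\<^bsub>G\<^esub> \<longleftrightarrow> g' = g \<otimes>\<^bsub>G\<^esub> inv\<^bsub>G\<^esub> A x"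
      proof
        assume "g' \<otimes>\<^bsub>G\<^esub> inv\<^bsub>G\<^esub> g \<otimes>\<^bsub>G\<^esub> A x = \<one>\<^bsub>G\<^esub>"
        then have "g' \<otimes>\<^bsub>G\<^esub> A x = g"
          using g g' Ax by (metis G.inv_closed G.inv_equality G.inv_inv G.m_assoc G.m_closed G.m_comm)
        then show "g' = g \<otimes>\<^bsub>G\<^esub> inv\<^bsub>G\<^esub> A x" using g g' Ax G.inv_solve_right by auto
      next
        assume "g' = g \<otimes>\<^bsub>G\<^esub> inv\<^bsub>G\<^esub> A x"
        then show "g' \<otimes>\<^bsub>G\<^esub> inv\<^bsub>G\<^esub> g \<otimes>\<^bsub>G\<^esub> A x = \<one>\<^bsub>G\<^esub>"
          using g Ax by (metis G.inv_closed G.inv_solve_right G.m_assoc G.m_closed G.m_comm G.r_inv)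
      qed
      moreover have "(\<Sum>\<xi>\<in>\<Xi>. c (g', \<xi>) * (\<xi> (A x) * \<psi> A (x, g', z))) =
        inverse (of_nat (card \<Xi>)) * (\<Sum>\<xi>\<in>\<Xi>. \<xi> (g' \<otimes>\<^bsub>G\<^esub> inv\<^bsub>G\<^esub> g \<otimes>\<^bsub>G\<^esub> A x)) * \<psi> A (x, g', z)"
        unfolding sum_distrib_left sum_distrib_right
        using \<Xi>(3) g g' Ax by (intro sum.cong) (auto simp: c_def charactersD(2) subset_iff)
      ultimately show ?thesis
        using delta[of "g' \<otimes>\<^bsub>G\<^esub> inv\<^bsub>G\<^esub> g \<otimes>\<^bsub>G\<^esub> A x"] g g' Ax \<Xi>(1,2) by auto
    qed
    have "(\<Sum>p\<in>carrier G \<times> \<Xi>. c p * (snd p (A x) * \<psi> A (x, fst p, z))) =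
        (\<Sum>g'\<in>carrier G. \<Sum>\<xi>\<in>\<Xi>. c (g', \<xi>) * (\<xi> (A x) * \<psi> A (x, g', z)))"
      by (simp add: sum.cartesian_product case_prod_unfold)
    also have "\<dots> = \<psi> A (x, g \<otimes>\<^bsub>G\<^esub> inv\<^bsub>G\<^esub> A x, z)"
      using finite_G g Ax by (simp add: inner)
    finally show ?thesis
      using G.apply_query_op[OF finite_X finite_G, of x g z d A "\<psi> A"] b Ax by (simp add: b')
  qed
  have "in_query_span (Suc t) (\<lambda>A. \<Sum>p\<in>carrier G \<times> \<Xi>. c p * (snd p (A x) * \<psi> A (x, fst p, z)))"
    using x \<Xi>(3) b by (intro in_query_span_sum in_query_span_Suc span) (auto simp: b' query_basis_def)
  then show ?thesis using eq by (rule in_query_span_cong)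
qed

text \<open>Gates are the same for all oracles, hence act inside the span; each query raises its
  index. Before any query the amplitudes are constant in \<open>A\<close>, and the empty product is
  the only available character.\<close>

lemma in_query_span_run:
  assumes "b \<in> query_basis X G (work_dim alg)"
  shows "in_query_span t (\<lambda>A. run X G alg A t b)"
  using assms
proof (induction t arbitrary: b)
  case 0
  then show ?case by (auto simp: in_query_span_def query_chars_0)
next
  case (Suc t)
  then show ?case by (auto intro!: in_query_span_apply_op in_query_span_query)
qed

section \<open>Character sums over the oracles and over the kernel\<close>

lemma sum_A_translate:
  assumes "B \<in> \<A>" shows "(\<Sum>A\<in>\<A>. h (A \<otimes>\<^bsub>K\<^esub> B)) = (\<Sum>A\<in>\<A>. h A)"
proof -
  interpret K: group K by (rule group_K)
  have inv: "inv\<^bsub>K\<^esub> B \<in> \<A>" using K.inv_closed[of B] assms by simp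
  have "bij_betw (\<lambda>A. A \<otimes>\<^bsub>K\<^esub> B) \<A> \<A>"
  proof (rule bij_betwI)
    show "(\<lambda>A. A \<otimes>\<^bsub>K\<^esub> B) \<in> \<A> \<rightarrow> \<A>" "(\<lambda>A. A \<otimes>\<^bsub>K\<^esub> inv\<^bsub>K\<^esub> B) \<in> \<A> \<rightarrow> \<A>"
      using mult_closed_A assms inv by auto
    show "A \<otimes>\<^bsub>K\<^esub> B \<otimes>\<^bsub>K\<^esub> inv\<^bsub>K\<^esub> B = A" "A \<otimes>\<^bsub>K\<^esub> inv\<^bsub>K\<^esub> B \<otimes>\<^bsub>K\<^esub> B = A" if "A \<in> \<A>" for A
      using that assms inv K.m_assoc[of A B "inv\<^bsub>K\<^esub> B"] K.m_assoc[of A "inv\<^bsub>K\<^esub> B" B]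
        K.r_inv[of B] K.l_inv[of B] K.r_one[of A] by simp_all
  qed
  then show ?thesis by (rule sum.reindex_bij_betw)
qed

lemma orthogonality_A:
  assumes "e \<in> query_chars X G \<A> q" "e' \<in> query_chars X G \<A> q"
  shows "(\<Sum>A\<in>\<A>. cnj (e A) * e' A) = (if e = e' then of_nat (card \<A>) else 0)"
proof -
  have "e \<in> characters K" "e' \<in> characters K" using assms query_chars_subset by auto
  moreover have "e = e' \<longleftrightarrow> (\<forall>A\<in>\<A>. e A = e' A)" using query_chars_eqI[OF assms] by blast
  ultimately show ?thesis
    using group.character_orthogonality[OF group_K, of e e'] finite_A by simp
qed

text \<open>Distinct characters of \<A> may have equal restrictions to \<B>. These cross terms
  survive the sum over the kernel, and they are what makes the equivalence classes appear in the
  bound.\<close>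

lemma orthogonality_B:
  assumes "e \<in> query_chars X G \<A> q" "e' \<in> query_chars X G \<A> q"
  shows "(\<Sum>B\<in>\<B>. cnj (e B) * e' B) = (if \<forall>B\<in>\<B>. e' B = e B then of_nat (card \<B>) else 0)"
proof -
  have "e \<in> characters L" "e' \<in> characters L"
    using assms query_chars_subset characters_K_imp_L by auto
  moreover have "(\<forall>B\<in>\<B>. e' B = e B) \<longleftrightarrow> (\<forall>B\<in>\<B>. e B = e' B)" by auto
  ultimately show ?thesis
    using group.character_orthogonality[OF group_L, of e e'] finite_B by simp
qed

lemma norm_query_char:
  "e \<in> query_chars X G \<A> q \<Longrightarrow> A \<in> \<A> \<Longrightarrow> cmod (e A) = 1"
  using group.norm_character[OF group_K, of e A] finite_A query_chars_subset by auto

text \<open>Stated for injective families because it serves twice: for the whole set of characters,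
  and for the branches \<open>z < k\<close> of the strategy.\<close>

lemma parseval_query_chars:
  assumes fin: "finite I" and e: "\<And>i. i \<in> I \<Longrightarrow> e i \<in> query_chars X G \<A> q" and inj: "inj_on e I"
  shows "(\<Sum>A\<in>\<A>. (cmod (\<Sum>i\<in>I. c i * e i A))\<^sup>2) = real (card \<A>) * (\<Sum>i\<in>I. (cmod (c i))\<^sup>2)"
proof -
  have "complex_of_real (\<Sum>A\<in>\<A>. (cmod (\<Sum>i\<in>I. c i * e i A))\<^sup>2) =
      (\<Sum>A\<in>\<A>. (\<Sum>i\<in>I. c i * e i A) * cnj (\<Sum>i\<in>I. c i * e i A))"
    by (simp only: of_real_sum complex_norm_square)
  also have "\<dots> = (\<Sum>A\<in>\<A>. \<Sum>i\<in>I. \<Sum>j\<in>I. c i * cnj (c j) * (cnj (e j A) * e i A))"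
    unfolding cnj_sum sum_product by (simp add: mult_ac)
  also have "\<dots> = (\<Sum>i\<in>I. \<Sum>A\<in>\<A>. \<Sum>j\<in>I. c i * cnj (c j) * (cnj (e j A) * e i A))"
    by (rule sum.swap)
  also have "\<dots> = (\<Sum>i\<in>I. \<Sum>j\<in>I. \<Sum>A\<in>\<A>. c i * cnj (c j) * (cnj (e j A) * e i A))"
    by (rule sum.cong[OF refl], rule sum.swap)
  also have "\<dots> = (\<Sum>i\<in>I. \<Sum>j\<in>I. if j = i then of_nat (card \<A>) * (c i * cnj (c i)) else 0)"
    unfolding sum_distrib_left[symmetric]
    by (intro sum.cong refl) (simp add: orthogonality_A[OF e e] inj_on_eq_iff[OF inj])
  also have "\<dots> = (\<Sum>i\<in>I. of_nat (card \<A>) * (c i * cnj (c i)))"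
    by (simp add: fin)
  also have "\<dots> = complex_of_real (real (card \<A>) * (\<Sum>i\<in>I. (cmod (c i))\<^sup>2))"
    by (simp add: sum_distrib_left complex_norm_square del: of_real_power)
  finally show ?thesis by (simp only: of_real_eq_iff)
qed

section \<open>Measurement statistics and the bound itself\<close>

text \<open>Grouping the oracles by \<open>f A\<close> counts each effect once per element of its
  fibre. Positivity allows every count to be raised to |\<B>|, after which completeness of the
  measurement applies.\<close>

lemma sum_povm_le:
  assumes povm: "is_povm S Y P" and S: "finite S"
  shows "(\<Sum>A\<in>\<A>. if f A \<in> Y then Re (sform S (P (f A)) v v) else 0)
         \<le> real (card \<B>) * (\<Sum>i\<in>S. (cmod (v i))\<^sup>2)"
proof -
  have Y: "finite Y" and pos: "\<And>y. y \<in> Y \<Longrightarrow> 0 \<le> Re (sform S (P y) v v)"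
    and one: "\<And>i j. i \<in> S \<Longrightarrow> j \<in> S \<Longrightarrow> (\<Sum>y\<in>Y. P y i j) = (if i = j then 1 else 0)"
    using povm is_positive_sform by (auto simp: is_povm_def)
  have total: "(\<Sum>y\<in>Y. sform S (P y) v v) = of_real (\<Sum>i\<in>S. (cmod (v i))\<^sup>2)"
  proof -
    have "(\<Sum>y\<in>Y. sform S (P y) v v) = (\<Sum>i\<in>S. \<Sum>y\<in>Y. \<Sum>j\<in>S. cnj (v i) * P y i j * v j)"
      unfolding sform_eq by (rule sum.swap)
    also have "\<dots> = (\<Sum>i\<in>S. \<Sum>j\<in>S. \<Sum>y\<in>Y. cnj (v i) * P y i j * v j)"
      by (rule sum.cong[OF refl], rule sum.swap)
    also have "\<dots> = (\<Sum>i\<in>S. \<Sum>j\<in>S. cnj (v i) * (if i = j then 1 else 0) * v j)"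
      unfolding sum_distrib_left[symmetric] sum_distrib_right[symmetric]
      by (intro sum.cong refl) (simp add: one)
    also have "\<dots> = braket S v v"
      using S by (simp add: braket_def if_distrib[of "\<lambda>x. x * _"] if_distrib[of "\<lambda>x. _ * x"] cong: if_cong)
    finally show ?thesis by (simp add: braket_self)
  qed
  have "(\<Sum>A\<in>\<A>. if f A \<in> Y then Re (sform S (P (f A)) v v) else 0)
      = (\<Sum>A\<in>{A\<in>\<A>. f A \<in> Y}. Re (sform S (P (f A)) v v))"
    using finite_A by (simp add: sum.inter_filter)
  also have "\<dots> = (\<Sum>y\<in>Y. \<Sum>A\<in>{A\<in>{A\<in>\<A>. f A \<in> Y}. f A = y}. Re (sform S (P (f A)) v v))"
    using finite_A Y by (intro sum.group[symmetric]) auto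
  also have "\<dots> = (\<Sum>y\<in>Y. real (card {A\<in>\<A>. f A = y}) * Re (sform S (P y) v v))"
  proof (intro sum.cong refl)
    fix y assume "y \<in> Y"
    then have "{A\<in>{A\<in>\<A>. f A \<in> Y}. f A = y} = {A\<in>\<A>. f A = y}" by auto
    then show "(\<Sum>A\<in>{A\<in>{A\<in>\<A>. f A \<in> Y}. f A = y}. Re (sform S (P (f A)) v v)) =
        real (card {A\<in>\<A>. f A = y}) * Re (sform S (P y) v v)" by simp
  qed
  also have "\<dots> \<le> (\<Sum>y\<in>Y. real (card \<B>) * Re (sform S (P y) v v))"
    using card_fibre_le pos by (intro sum_mono mult_right_mono) auto
  also have "\<dots> = real (card \<B>) * Re (\<Sum>y\<in>Y. sform S (P y) v v)"
    by (simp add: sum_distrib_left)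
  finally show ?thesis by (simp add: total del: of_real_sum)
qed

lemma success_prob_le:
  assumes valid: "valid_algorithm X G q alg"
    and M: "\<And>e. e \<in> query_chars X G \<A> q \<Longrightarrow> card (query_char_class X G \<A> q \<B> e) \<le> M"
  shows "success_prob X G \<A> f q alg \<le> real (card \<B>) / real (card \<A>) * real M"
proof -
  define S where "S = query_basis X G (work_dim alg)"
  define E where "E = query_chars X G \<A> q"
  define Y where "Y = outcomes alg"
  define \<psi> where "\<psi> A = run X G alg A q" for A
  define R where "R e e' \<longleftrightarrow> (\<forall>B\<in>\<B>. e' B = e B)" for e e' :: "('x \<Rightarrow> 'g) \<Rightarrow> complex"
  have finS: "finite S" unfolding S_def by (rule finite_query_basis[OF finite_X finite_G])
  have finE: "finite E" unfolding E_def by (rule finite_query_chars)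
  have povm: "is_povm S Y (povm alg)"
    using valid by (simp add: valid_algorithm_def S_def Y_def Let_def)
  have "\<forall>b\<in>S. \<exists>c. \<forall>A\<in>\<A>. \<psi> A b = (\<Sum>e\<in>E. c e * e A)"
    using in_query_span_run unfolding in_query_span_def \<psi>_def S_def E_def by blast
  then obtain c where c: "\<And>b A. b \<in> S \<Longrightarrow> A \<in> \<A> \<Longrightarrow> \<psi> A b = (\<Sum>e\<in>E. c b e * e A)"
    by metis
  define p where "p e b = c b e" for e b
  have \<psi>: "\<psi> A b = (\<Sum>e\<in>E. e A * p e b)" if "b \<in> S" "A \<in> \<A>" for A b
    using c[OF that] by (simp add: p_def mult.commute)
  have weight: "(\<Sum>e\<in>E. \<Sum>b\<in>S. (cmod (p e b))\<^sup>2) = 1"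
  proof -
    have "complex_of_real (\<Sum>b\<in>S. (cmod (\<psi> A b))\<^sup>2) = 1" if "A \<in> \<A>" for A
      using group.braket_run[OF group_G finite_X finite_G _ valid, of A q] oracle_closed[OF that]
      unfolding \<psi>_def S_def braket_self by simp
    then have norm: "(\<Sum>b\<in>S. (cmod (\<psi> A b))\<^sup>2) = 1" if "A \<in> \<A>" for A
      using that by (metis of_real_eq_1_iff)
    have "real (card \<A>) = (\<Sum>A\<in>\<A>. \<Sum>b\<in>S. (cmod (\<psi> A b))\<^sup>2)"
      by (simp add: norm)
    also have "\<dots> = (\<Sum>b\<in>S. \<Sum>A\<in>\<A>. (cmod (\<Sum>e\<in>E. c b e * e A))\<^sup>2)"
      by (subst sum.swap) (simp add: c)
    also have "\<dots> = real (card \<A>) * (\<Sum>b\<in>S. \<Sum>e\<in>E. (cmod (p e b))\<^sup>2)"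
      using parseval_query_chars[of E "\<lambda>e. e" q] finE by (simp add: sum_distrib_left p_def E_def)
    finally have "(\<Sum>b\<in>S. \<Sum>e\<in>E. (cmod (p e b))\<^sup>2) = 1" using card_A_pos by simp
    then show ?thesis by (subst sum.swap)
  qed
  \<comment> \<open>The oracle selecting the effect and the vector being measured are separate
    arguments: a shift by \<B> leaves the effect alone while the state moves.\<close>
  define out where "out A v = (if f A \<in> Y then Re (sform S (povm alg (f A)) v v) else 0)" for A v
  have coset: "(\<Sum>B\<in>\<B>. out A (\<psi> (A \<otimes>\<^bsub>K\<^esub> B))) \<le> real (card \<B>) * real M * (\<Sum>e\<in>E. out A (p e))"
    if A: "A \<in> \<A>" for A
  proof (cases "f A \<in> Y")
    case True
    define s where "s = sform S (povm alg (f A))"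
    have pos: "is_positive S (povm alg (f A))" using povm True by (simp add: is_povm_def)
    \<comment> \<open>With \<open>e A\<close> absorbed into \<open>u e\<close>, the shifted state
      has coefficients \<open>e B\<close>, so the sum over \<B> only meets characters of
      \<B>.\<close>
    define u where "u e = (\<lambda>b. e A * p e b)" for e
    have s_u: "s (u e) (u e') = cnj (e A) * e' A * s (p e) (p e')" for e e'
      unfolding s_def u_def by (rule sform_scale)
    have "s (\<psi> (A \<otimes>\<^bsub>K\<^esub> B)) (\<psi> (A \<otimes>\<^bsub>K\<^esub> B)) =
        (\<Sum>e\<in>E. \<Sum>e'\<in>E. cnj (e B) * e' B * s (u e) (u e'))" if B: "B \<in> \<B>" for B
    proof -
      have B': "B \<in> \<A>" using B B_subset by auto
      have "\<psi> (A \<otimes>\<^bsub>K\<^esub> B) b = (\<Sum>e\<in>E. e B * u e b)" if "b \<in> S" for b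
        unfolding \<psi>[OF that mult_closed_A[OF A B']]
      proof (intro sum.cong refl)
        fix e assume "e \<in> E"
        then have "e \<in> characters K" using query_chars_subset E_def by auto
        then show "e (A \<otimes>\<^bsub>K\<^esub> B) * p e b = e B * u e b"
          using charactersD(2)[of e K A B] A B' by (simp add: u_def)
      qed
      then have "s (\<psi> (A \<otimes>\<^bsub>K\<^esub> B)) (\<psi> (A \<otimes>\<^bsub>K\<^esub> B)) =
          s (\<lambda>b. \<Sum>e\<in>E. e B * u e b) (\<lambda>b. \<Sum>e\<in>E. e B * u e b)"
        unfolding s_def by (intro sform_cong) auto
      then show ?thesis unfolding s_def sform_sum .
    qed
    then have "(\<Sum>B\<in>\<B>. s (\<psi> (A \<otimes>\<^bsub>K\<^esub> B)) (\<psi> (A \<otimes>\<^bsub>K\<^esub> B))) =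
        (\<Sum>B\<in>\<B>. \<Sum>e\<in>E. \<Sum>e'\<in>E. cnj (e B) * e' B * s (u e) (u e'))"
      by simp
    also have "\<dots> = (\<Sum>e\<in>E. \<Sum>B\<in>\<B>. \<Sum>e'\<in>E. cnj (e B) * e' B * s (u e) (u e'))"
      by (rule sum.swap)
    also have "\<dots> = (\<Sum>e\<in>E. \<Sum>e'\<in>E. \<Sum>B\<in>\<B>. cnj (e B) * e' B * s (u e) (u e'))"
      by (rule sum.cong[OF refl], rule sum.swap)
    also have "\<dots> = (\<Sum>e\<in>E. \<Sum>e'\<in>E. if R e e' then of_nat (card \<B>) * s (u e) (u e') else 0)"
      unfolding sum_distrib_right[symmetric]
      by (intro sum.cong refl) (simp add: orthogonality_B E_def R_def)
    also have "\<dots> = of_nat (card \<B>) * (\<Sum>e\<in>E. \<Sum>e'\<in>{e'\<in>E. R e e'}. s (u e) (u e'))"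
      using finE by (simp add: sum_distrib_left sum.inter_filter if_distrib[of "\<lambda>x. _ * x"] cong: if_cong)
    finally have "(\<Sum>B\<in>\<B>. Re (s (\<psi> (A \<otimes>\<^bsub>K\<^esub> B)) (\<psi> (A \<otimes>\<^bsub>K\<^esub> B)))) =
        real (card \<B>) * Re (\<Sum>e\<in>E. \<Sum>e'\<in>{e'\<in>E. R e e'}. s (u e) (u e'))"
      by (simp flip: Re_sum)
    also have "\<dots> \<le> real (card \<B>) * (\<Sum>e\<in>E. real (card {e'\<in>E. R e e'}) * Re (s (u e) (u e)))"
      unfolding s_def
      by (intro mult_left_mono sform_related_pairs_le finE pos) (auto simp: R_def)
    also have "\<dots> \<le> real (card \<B>) * (\<Sum>e\<in>E. real M * Re (s (u e) (u e)))"
    proof (intro mult_left_mono sum_mono mult_right_mono)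
      fix e assume "e \<in> E"
      then show "real (card {e' \<in> E. R e e'}) \<le> real M"
        using M by (simp add: query_char_class_def E_def R_def)
      show "0 \<le> Re (s (u e) (u e))" unfolding s_def using pos by (rule is_positive_sform)
    qed simp
    \<comment> \<open>The phases \<open>e A\<close> have modulus 1 and drop out; what remains
      depends on \<open>A\<close> through the effect only, as \<open>sum_povm_le\<close>
      requires.\<close>
    also have "\<dots> = real (card \<B>) * (\<Sum>e\<in>E. real M * Re (s (p e) (p e)))"
    proof -
      have "s (u e) (u e) = s (p e) (p e)" if "e \<in> E" for e
        using norm_query_char[of e q A] that A unfolding s_u E_def
        by (simp add: mult.commute[of "cnj _"] complex_norm_square[symmetric])
      then show ?thesis by simp
    qed
    finally have "(\<Sum>B\<in>\<B>. Re (s (\<psi> (A \<otimes>\<^bsub>K\<^esub> B)) (\<psi> (A \<otimes>\<^bsub>K\<^esub> B))))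
        \<le> real (card \<B>) * real M * (\<Sum>e\<in>E. Re (s (p e) (p e)))"
      by (simp add: sum_distrib_left mult.assoc)
    then show ?thesis using True by (simp add: out_def s_def)
  qed (simp add: out_def)
  have succ: "success_prob X G \<A> f q alg = (\<Sum>A\<in>\<A>. out A (\<psi> A)) / real (card \<A>)"
    unfolding success_prob_def output_prob_def out_def sform_def S_def \<psi>_def Y_def Let_def ..
  \<comment> \<open>Each translation by \<open>B\<close> preserves the total, so |\<B>| copies of it
    become a sum of coset sums. These copies cancel one of the two factors |\<B>| that arise
    below.\<close>
  have "real (card \<B>) * (\<Sum>A\<in>\<A>. out A (\<psi> A)) = (\<Sum>B\<in>\<B>. \<Sum>A\<in>\<A>. out A (\<psi> A))" by simp
  also have "\<dots> = (\<Sum>B\<in>\<B>. \<Sum>A\<in>\<A>. out (A \<otimes>\<^bsub>K\<^esub> B) (\<psi> (A \<otimes>\<^bsub>K\<^esub> B)))"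
    using B_subset by (intro sum.cong refl sum_A_translate[symmetric]) auto
  also have "\<dots> = (\<Sum>B\<in>\<B>. \<Sum>A\<in>\<A>. out A (\<psi> (A \<otimes>\<^bsub>K\<^esub> B)))"
    by (intro sum.cong refl) (simp only: out_def f_mult_kernel)
  also have "\<dots> = (\<Sum>A\<in>\<A>. \<Sum>B\<in>\<B>. out A (\<psi> (A \<otimes>\<^bsub>K\<^esub> B)))"
    by (rule sum.swap)
  also have "\<dots> \<le> (\<Sum>A\<in>\<A>. real (card \<B>) * real M * (\<Sum>e\<in>E. out A (p e)))"
    by (intro sum_mono coset)
  also have "\<dots> = real (card \<B>) * real M * (\<Sum>e\<in>E. \<Sum>A\<in>\<A>. out A (p e))"
    unfolding sum_distrib_left[symmetric] by (subst sum.swap) (rule refl)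
  also have "\<dots> \<le> real (card \<B>) * real M * (\<Sum>e\<in>E. real (card \<B>) * (\<Sum>b\<in>S. (cmod (p e b))\<^sup>2))"
    unfolding out_def by (intro mult_left_mono sum_mono sum_povm_le povm finS) simp
  also have "\<dots> = real (card \<B>) * (real (card \<B>) * real M)"
    unfolding sum_distrib_left[symmetric] weight by simp
  finally have "(\<Sum>A\<in>\<A>. out A (\<psi> A)) \<le> real (card \<B>) * real M"
    using card_B_pos by simp
  then show ?thesis unfolding succ by (simp add: divide_right_mono)
qed

end

section \<open>An optimal algorithm\<close>

text \<open>Cauchy-Schwarz as the one-dimensional case of \<open>sform_related_pairs_le\<close>,
  with the identity as effect and all pairs related.\<close>

lemma norm_sum_squared_le:
  fixes a :: "'i \<Rightarrow> complex"
  assumes "finite I"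
  shows "(cmod (\<Sum>i\<in>I. a i))\<^sup>2 \<le> real (card I) * (\<Sum>i\<in>I. (cmod (a i))\<^sup>2)"
proof -
  let ?s = "sform {()} (\<lambda>_ _. 1)"
  have s: "?s \<phi> \<psi> = cnj (\<phi> ()) * \<psi> ()" for \<phi> \<psi> by (simp add: sform_eq)
  have norm: "cnj z * z = of_real ((cmod z)\<^sup>2)" for z by (simp add: complex_norm_square mult.commute del: of_real_power)
  have "is_positive {()} (\<lambda>_ _. 1)"
    unfolding is_positive_def sform_def[symmetric] s norm by simp
  from sform_related_pairs_le[OF assms this, of "\<lambda>_ _. True" "\<lambda>i _. a i"]
  have "Re (\<Sum>i\<in>I. \<Sum>j\<in>I. cnj (a i) * a j) \<le> (\<Sum>i\<in>I. real (card I) * (cmod (a i))\<^sup>2)"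
    by (simp add: s norm del: of_real_power Re_sum)
  moreover have "(\<Sum>i\<in>I. \<Sum>j\<in>I. cnj (a i) * a j) = of_real ((cmod (\<Sum>i\<in>I. a i))\<^sup>2)"
    unfolding norm[symmetric] cnj_sum sum_product ..
  ultimately show ?thesis by (simp add: sum_distrib_left del: of_real_power)
qed

section \<open>Permutations of the basis with phases\<close>

definition monomial_op :: "('b \<Rightarrow> 'b) \<Rightarrow> ('b \<Rightarrow> complex) \<Rightarrow> 'b op" where
  "monomial_op \<tau> c = (\<lambda>i j. if j = \<tau> i then c i else 0)"

lemma apply_monomial_op:
  assumes "finite S" "\<tau> i \<in> S"
  shows "apply_op S (monomial_op \<tau> c) \<psi> i = c i * \<psi> (\<tau> i)"
proof -
  have "apply_op S (monomial_op \<tau> c) \<psi> i = (\<Sum>j\<in>S. if j = \<tau> i then c i * \<psi> j else 0)"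
    unfolding apply_op_def monomial_op_def by (intro sum.cong) auto
  then show ?thesis using assms by simp
qed

text \<open>For an involution the nonzero entries of row \<open>i\<close> and of column
  \<open>i\<close> sit at the same index, so both orthogonality relations are checked alike.\<close>

lemma monomial_op_unitary:
  assumes fin: "finite S" and closed: "\<And>i. i \<in> S \<Longrightarrow> \<tau> i \<in> S" and inv: "\<And>i. i \<in> S \<Longrightarrow> \<tau> (\<tau> i) = i"
    and c: "\<And>i. i \<in> S \<Longrightarrow> cmod (c i) = 1"
  shows "is_unitary S (monomial_op \<tau> c)"
  unfolding is_unitary_def
proof (intro conjI ballI)
  fix i j assume ij: "i \<in> S" "j \<in> S"
  have c': "c k * cnj (c k) = 1" if "k \<in> S" for k
    using c[OF that] by (simp add: complex_norm_square[symmetric])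
  have "(\<Sum>k\<in>S. cnj (monomial_op \<tau> c k i) * monomial_op \<tau> c k j) =
      (\<Sum>k\<in>S. if k = \<tau> i then (if i = j then 1 else 0) else 0)"
  proof (intro sum.cong refl)
    fix k assume k: "k \<in> S"
    then have "i = \<tau> k \<longleftrightarrow> k = \<tau> i" using inv ij(1) by metis
    then show "cnj (monomial_op \<tau> c k i) * monomial_op \<tau> c k j =
        (if k = \<tau> i then (if i = j then 1 else 0) else 0)"
      using c'[OF k] ij(1) inv by (auto simp: monomial_op_def mult.commute)
  qed
  then show "(\<Sum>k\<in>S. cnj (monomial_op \<tau> c k i) * monomial_op \<tau> c k j) = (if i = j then 1 else 0)"
    using fin closed[OF ij(1)] by simp
  have "(\<Sum>k\<in>S. monomial_op \<tau> c i k * cnj (monomial_op \<tau> c j k)) =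
      (\<Sum>k\<in>S. if k = \<tau> i then (if i = j then 1 else 0) else 0)"
  proof (intro sum.cong refl)
    fix k
    have "\<tau> i = \<tau> j \<longleftrightarrow> i = j" using inv ij by metis
    then show "monomial_op \<tau> c i k * cnj (monomial_op \<tau> c j k) =
        (if k = \<tau> i then (if i = j then 1 else 0) else 0)"
      using c'[OF ij(1)] by (auto simp: monomial_op_def)
  qed
  then show "(\<Sum>k\<in>S. monomial_op \<tau> c i k * cnj (monomial_op \<tau> c j k)) = (if i = j then 1 else 0)"
    using fin closed[OF ij(1)] by simp
qed

lemma sum_query_basis_fixed_point:
  assumes "finite X" "\<And>z. z < d \<Longrightarrow> y z \<in> X"
  shows "(\<Sum>(x, g, z)\<in>query_basis X G d. if x = y z then h g z else 0) =
         (\<Sum>z<d. \<Sum>g\<in>carrier G. h g z)"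
proof -
  have "(\<Sum>(x, g, z)\<in>query_basis X G d. if x = y z then h g z else 0) =
      (\<Sum>x\<in>X. \<Sum>p\<in>carrier G \<times> {..<d}. if x = y (snd p) then h (fst p) (snd p) else 0)"
    unfolding query_basis_def by (subst sum.cartesian_product) (simp add: case_prod_unfold)
  also have "\<dots> = (\<Sum>p\<in>carrier G \<times> {..<d}. \<Sum>x\<in>X. if x = y (snd p) then h (fst p) (snd p) else 0)"
    by (rule sum.swap)
  also have "\<dots> = (\<Sum>p\<in>carrier G \<times> {..<d}. h (fst p) (snd p))"
    using assms by (intro sum.cong refl) auto
  also have "\<dots> = (\<Sum>g\<in>carrier G. \<Sum>z<d. h g z)"
    by (subst sum.cartesian_product) (simp add: case_prod_unfold)
  also have "\<dots> = (\<Sum>z<d. \<Sum>g\<in>carrier G. h g z)"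
    by (rule sum.swap)
  finally show ?thesis .
qed

text \<open>
  The branch with workspace value \<open>z < k\<close> makes the phase queries of one member \<open>e z\<close> of an
  equivalence class; all members coincide with \<open>e\<^sub>0\<close> on \<open>\<B>\<close>. After the last query
  the query register is reset to \<open>x\<^sub>0\<close> and the trivial character.
\<close>

locale query_strategy = oracle_problem X G \<A> H f \<B>
  for X :: "'x set" and G :: "('g, 'm) monoid_scheme" and \<A> and H :: "('h, 'n) monoid_scheme"
    and f :: "('x \<Rightarrow> 'g) \<Rightarrow> 'h" and \<B> +
  fixes q k :: nat and x :: "nat \<Rightarrow> nat \<Rightarrow> 'x" and \<xi> :: "nat \<Rightarrow> nat \<Rightarrow> 'g \<Rightarrow> complex"
    and x\<^sub>0 :: 'x and e\<^sub>0 :: "('x \<Rightarrow> 'g) \<Rightarrow> complex"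
  assumes k_pos: "k > 0"
    and x_in: "\<And>z i. z < k \<Longrightarrow> x z i \<in> X"
    and \<xi>_in: "\<And>z i. z < k \<Longrightarrow> \<xi> z i \<in> characters G"
    and x_final: "\<And>z. z < k \<Longrightarrow> x z q = x\<^sub>0"
    and \<xi>_final: "\<And>z. z < k \<Longrightarrow> \<xi> z q = (\<lambda>_. 1)"
    and inj_query_char: "inj_on (\<lambda>z. query_char \<A> q (x z) (\<xi> z)) {..<k}"
    and e\<^sub>0: "\<And>z B. z < k \<Longrightarrow> B \<in> \<B> \<Longrightarrow> query_char \<A> q (x z) (\<xi> z) B = e\<^sub>0 B"
begin

definition e where "e z = query_char \<A> q (x z) (\<xi> z)"
definition S where "S = query_basis X G k"
text \<open>In each of the k branches every group element carries amplitude at exactly one position: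
  k |G| basis vectors of equal modulus.\<close>

definition amp :: complex where "amp = of_real (1 / sqrt (real k * real (card (carrier G))))"

text \<open>The conjugated character puts the group register into a Fourier vector, on which adding
  \<open>A x\<close> is multiplication by the value of the character at \<open>A x\<close>. The
  product collects the phases of the first \<open>t\<close> queries.\<close>

definition phased_state :: "nat \<Rightarrow> ('x \<Rightarrow> 'g) \<Rightarrow> ('x \<times> 'g \<times> nat) state" where
  "phased_state t A = (\<lambda>(y, g, z).
     if y = x z t then amp * cnj (\<xi> z t g) * (\<Prod>i<t. \<xi> z i (A (x z i))) else 0)"

text \<open>A transposition leads to the next query point and is its own inverse, as
  \<open>monomial_op_unitary\<close> demands.\<close>

definition move :: "nat \<Rightarrow> 'x \<times> 'g \<times> nat \<Rightarrow> 'x \<times> 'g \<times> nat" where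
  "move t = (\<lambda>(y, g, z). (Transposition.transpose (x z t) (x z (Suc t)) y, g, z))"

definition rephase :: "nat \<Rightarrow> 'x \<times> 'g \<times> nat \<Rightarrow> complex" where
  "rephase t = (\<lambda>(y, g, z). cnj (\<xi> z (Suc t) g) * \<xi> z t g)"

text \<open>Gate 0 is the identity because \<open>init\<close> is already the phased state at time
  0.\<close>

definition strategy_gate :: "nat \<Rightarrow> ('x \<times> 'g \<times> nat) op" where
  "strategy_gate t = (case t of 0 \<Rightarrow> monomial_op (\<lambda>b. b) (\<lambda>_. 1)
                              | Suc t \<Rightarrow> monomial_op (move t) (rephase t))"

definition final_state :: "('x \<Rightarrow> 'g) \<Rightarrow> ('x \<times> 'g \<times> nat) state" where
  "final_state A = (\<lambda>(y, g, z). if y = x\<^sub>0 then amp * e z A else 0)"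

text \<open>By orthogonality of the k characters, the projections onto all final states add up to
  |\<A>| / k times the projection onto their span; the prefactor normalises this.\<close>

definition frame_op :: "('x \<Rightarrow> 'g) set \<Rightarrow> ('x \<times> 'g \<times> nat) op" where
  "frame_op T = (\<lambda>i j. of_real (real k / real (card \<A>)) *
                 (\<Sum>A\<in>T. final_state A i * cnj (final_state A j)))"

text \<open>
  On the span of the final states the rescaled projections resolve the identity;
  the complement is assigned to the outcome of the neutral element.
\<close>

definition strategy_povm :: "'h \<Rightarrow> ('x \<times> 'g \<times> nat) op" where
  "strategy_povm y = (\<lambda>i j. frame_op {A\<in>\<A>. f A = y} i j +
     (if y = f \<one>\<^bsub>K\<^esub> then (if i = j then 1 else 0) - frame_op \<A> i j else 0))"

text \<open>At time 0 the product of past phases is empty, so any oracle may be passed to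
  \<open>phased_state\<close>.\<close>

definition strategy :: "('x, 'g, 'h) query_algorithm" where
  "strategy = \<lparr>work_dim = k, init = phased_state 0 (\<lambda>_. undefined), gate = strategy_gate,
     outcomes = f ` \<A>, povm = strategy_povm\<rparr>"

section \<open>Evolution of the strategy\<close>

lemma x\<^sub>0_in: "x\<^sub>0 \<in> X"
  using x_in[OF k_pos, of q] x_final[OF k_pos] by simp

lemma finite_S: "finite S"
  unfolding S_def by (rule finite_query_basis[OF finite_X finite_G])

lemma norm_\<xi>: "z < k \<Longrightarrow> g \<in> carrier G \<Longrightarrow> cmod (\<xi> z i g) = 1"
  using group.norm_character[OF group_G finite_G \<xi>_in] by blast

lemma amp_squared: "(cmod amp)\<^sup>2 * (real k * real (card (carrier G))) = 1"
proof -
  have "card (carrier G) > 0"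
    using finite_G group_G by (metis card_gt_0_iff empty_iff group.is_monoid monoid.one_closed)
  then show ?thesis using k_pos by (simp add: amp_def norm_divide power_divide norm_mult)
qed

lemma amp_norm_sum:
  assumes y: "\<And>z. z < k \<Longrightarrow> y z \<in> X" and c: "\<And>z g. z < k \<Longrightarrow> g \<in> carrier G \<Longrightarrow> cmod (c g z) = 1"
  shows "(\<Sum>b\<in>S. (cmod (case b of (x', g, z) \<Rightarrow> if x' = y z then amp * c g z else 0))\<^sup>2) = 1"
proof -
  have "(\<Sum>b\<in>S. (cmod (case b of (x', g, z) \<Rightarrow> if x' = y z then amp * c g z else 0))\<^sup>2)
     = (\<Sum>(x', g, z)\<in>S. if x' = y z then (cmod (amp * c g z))\<^sup>2 else 0)"
    by (intro sum.cong refl) auto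
  also have "\<dots> = (\<Sum>z<k. \<Sum>g\<in>carrier G. (cmod (amp * c g z))\<^sup>2)"
    unfolding S_def using finite_X y by (rule sum_query_basis_fixed_point)
  also have "\<dots> = (\<Sum>z<k. \<Sum>g\<in>carrier G. (cmod amp)\<^sup>2)"
    by (intro sum.cong refl) (simp add: norm_mult c)
  also have "\<dots> = 1" using amp_squared by (simp add: mult_ac)
  finally show ?thesis .
qed

lemma gate_unitary: "is_unitary S (strategy_gate t)"
proof (cases t)
  case 0
  then show ?thesis
    using monomial_op_unitary[OF finite_S, of "\<lambda>b. b" "\<lambda>_. 1"] by (simp add: strategy_gate_def)
next
  case (Suc t)
  have "is_unitary S (monomial_op (move t) (rephase t))"
    by (rule monomial_op_unitary[OF finite_S])
       (auto simp: S_def query_basis_def move_def rephase_def norm_mult norm_\<xi> x_in Transposition.transpose_def)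
  then show ?thesis by (simp add: strategy_gate_def Suc)
qed

text \<open>Phase kickback: the query shifts the argument of the conjugated character by the inverse
  of \<open>A y\<close>, which comes out as the factor \<open>\<xi> z t (A y)\<close>.\<close>

lemma query_phased_state:
  assumes A: "A \<in> \<A>" and b: "(y, g, z) \<in> S"
  shows "apply_op S (query_op G A) (phased_state t A) (y, g, z) =
    (if y = x z t then amp * cnj (\<xi> z t g) * (\<Prod>i<Suc t. \<xi> z i (A (x z i))) else 0)"
proof -
  interpret G: group G by (rule group_G)
  have g: "g \<in> carrier G" and z: "z < k" and y: "y \<in> X"
    using b by (auto simp: S_def query_basis_def)
  have Ay: "A y \<in> carrier G" using oracle_closed A y by blast
  have "cnj (\<xi> z t (g \<otimes>\<^bsub>G\<^esub> inv\<^bsub>G\<^esub> A y)) = cnj (\<xi> z t g) * \<xi> z t (A y)"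
  proof -
    have "\<xi> z t g = \<xi> z t (g \<otimes>\<^bsub>G\<^esub> inv\<^bsub>G\<^esub> A y) * \<xi> z t (A y)"
      using charactersD(2)[OF \<xi>_in[OF z, of t], of "g \<otimes>\<^bsub>G\<^esub> inv\<^bsub>G\<^esub> A y" "A y"] g Ay
      by (simp add: G.m_assoc)
    then show ?thesis
      using G.character_mult_cnj[OF finite_G \<xi>_in[OF z] Ay, of t] by (simp add: mult.assoc)
  qed
  then show ?thesis
    using G.apply_query_op[OF finite_X finite_G, of y g z k A "phased_state t A"] b Ay
    by (cases "y = x z t") (simp_all add: S_def phased_state_def mult_ac)
qed

lemma run_strategy:
  assumes A: "A \<in> \<A>" and "b \<in> S"
  shows "run X G strategy A t b = phased_state t A b"
  using \<open>b \<in> S\<close>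
proof (induction t arbitrary: b)
  case 0
  then show ?case
    using apply_monomial_op[OF finite_S, of "\<lambda>b. b" b]
    by (cases b) (simp add: strategy_def strategy_gate_def phased_state_def S_def[symmetric])
next
  case (Suc t)
  obtain y g z where b: "b = (y, g, z)" by (cases b)
  have gz: "g \<in> carrier G" "z < k" using Suc.prems by (auto simp: b S_def query_basis_def)
  have moved: "move t b \<in> S"
    using Suc.prems x_in by (auto simp: S_def query_basis_def move_def Transposition.transpose_def)
  let ?\<psi> = "apply_op S (query_op G A) (phased_state t A)"
  have "run X G strategy A (Suc t) b = apply_op S (monomial_op (move t) (rephase t)) ?\<psi> b"
    using apply_op_cong[of S "run X G strategy A t" "phased_state t A"] Suc.IH
    by (simp add: strategy_def strategy_gate_def S_def[symmetric])
  also have "\<dots> = rephase t b * ?\<psi> (move t b)"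
    using finite_S moved by (rule apply_monomial_op)
  also have "\<dots> = phased_state (Suc t) A b"
  proof -
    \<comment> \<open>This includes coinciding query points, for which the transposition is the
      identity.\<close>
    have "Transposition.transpose (x z t) (x z (Suc t)) y = x z t \<longleftrightarrow> y = x z (Suc t)"
      by (auto simp: Transposition.transpose_def)
    moreover have "\<xi> z t g * cnj (\<xi> z t g) = 1"
      using group.character_mult_cnj[OF group_G finite_G \<xi>_in] gz by blast
    ultimately show ?thesis
      using query_phased_state[OF A, of _ g z t] moved
      by (simp add: b move_def rephase_def phased_state_def mult_ac)
  qed
  finally show ?case .
qed

lemma run_strategy_final:
  assumes "A \<in> \<A>" "b \<in> S"
  shows "run X G strategy A q b = final_state A b"
  using run_strategy[OF assms, of q] assms
  by (auto simp: phased_state_def final_state_def e_def query_char_def x_final \<xi>_final S_def query_basis_def)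

lemma e_in: "z < k \<Longrightarrow> e z \<in> query_chars X G \<A> q"
  unfolding e_def query_chars_def using x_in \<xi>_in by blast

section \<open>The measurement of the strategy and its success probability\<close>

lemma sform_frame_op:
  "sform S (frame_op T) \<psi> \<psi> =
   of_real (real k / real (card \<A>) * (\<Sum>A\<in>T. (cmod (braket S (final_state A) \<psi>))\<^sup>2))"
proof -
  have "sform S (frame_op T) \<psi> \<psi> = (\<Sum>i\<in>S. \<Sum>j\<in>S. \<Sum>A\<in>T. of_real (real k / real (card \<A>)) *
      (cnj (cnj (final_state A i) * \<psi> i) * (cnj (final_state A j) * \<psi> j)))"
    by (simp add: sform_eq frame_op_def sum_distrib_left sum_distrib_right mult_ac)
  also have "\<dots> = (\<Sum>i\<in>S. \<Sum>A\<in>T. \<Sum>j\<in>S. of_real (real k / real (card \<A>)) *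
      (cnj (cnj (final_state A i) * \<psi> i) * (cnj (final_state A j) * \<psi> j)))"
    by (rule sum.cong[OF refl], rule sum.swap)
  also have "\<dots> = (\<Sum>A\<in>T. \<Sum>i\<in>S. \<Sum>j\<in>S. of_real (real k / real (card \<A>)) *
      (cnj (cnj (final_state A i) * \<psi> i) * (cnj (final_state A j) * \<psi> j)))"
    by (rule sum.swap)
  also have "\<dots> = (\<Sum>A\<in>T. of_real (real k / real (card \<A>)) *
      (cnj (braket S (final_state A) \<psi>) * braket S (final_state A) \<psi>))"
    unfolding braket_def cnj_sum sum_product by (simp only: sum_distrib_left)
  also have "\<dots> = of_real (real k / real (card \<A>) * (\<Sum>A\<in>T. (cmod (braket S (final_state A) \<psi>))\<^sup>2))"
    by (simp only: mult.commute[of "cnj _"] complex_norm_square[symmetric] of_real_mult of_real_sum sum_distrib_left)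
  finally show ?thesis .
qed

text \<open>This makes the complement in \<open>strategy_povm\<close> positive. Parseval evaluates
  the sum over the oracles, and Cauchy-Schwarz in the group register gives the inequality.\<close>

lemma final_states_bessel:
  "real k / real (card \<A>) * (\<Sum>A\<in>\<A>. (cmod (braket S (final_state A) \<psi>))\<^sup>2)
   \<le> (\<Sum>b\<in>S. (cmod (\<psi> b))\<^sup>2)"
proof -
  \<comment> \<open>The amplitudes are conjugated so that the characters enter the expansion
    unconjugated, as in \<open>parseval_query_chars\<close>.\<close>
  define v where "v z = (\<Sum>g\<in>carrier G. amp * cnj (\<psi> (x\<^sub>0, g, z)))" for z
  have "cnj (braket S (final_state A) \<psi>) = (\<Sum>z<k. v z * e z A)" for A
  proof -
    have "cnj (braket S (final_state A) \<psi>) =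
        (\<Sum>(x', g, z)\<in>S. if x' = x\<^sub>0 then amp * e z A * cnj (\<psi> (x\<^sub>0, g, z)) else 0)"
      unfolding braket_def cnj_sum by (intro sum.cong refl) (auto simp: final_state_def)
    also have "\<dots> = (\<Sum>z<k. \<Sum>g\<in>carrier G. amp * e z A * cnj (\<psi> (x\<^sub>0, g, z)))"
      unfolding S_def using finite_X x\<^sub>0_in by (intro sum_query_basis_fixed_point)
    finally show ?thesis by (simp add: v_def sum_distrib_left sum_distrib_right mult_ac)
  qed
  then have "(\<Sum>A\<in>\<A>. (cmod (braket S (final_state A) \<psi>))\<^sup>2) =
      (\<Sum>A\<in>\<A>. (cmod (\<Sum>z<k. v z * e z A))\<^sup>2)"
    by (metis complex_mod_cnj)
  also have "\<dots> = real (card \<A>) * (\<Sum>z<k. (cmod (v z))\<^sup>2)"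
    using e_in inj_query_char unfolding e_def[symmetric]
    by (intro parseval_query_chars[where q = q]) auto
  finally have "real k / real (card \<A>) * (\<Sum>A\<in>\<A>. (cmod (braket S (final_state A) \<psi>))\<^sup>2) =
      (\<Sum>z<k. real k * (cmod (v z))\<^sup>2)"
    using card_A_pos by (simp add: sum_distrib_left)
  also have "\<dots> \<le> (\<Sum>z<k. \<Sum>g\<in>carrier G. (cmod (\<psi> (x\<^sub>0, g, z)))\<^sup>2)"
  proof (intro sum_mono)
    fix z
    have "(cmod (v z))\<^sup>2 \<le> real (card (carrier G)) * (\<Sum>g\<in>carrier G. (cmod (amp * cnj (\<psi> (x\<^sub>0, g, z))))\<^sup>2)"
      unfolding v_def by (rule norm_sum_squared_le[OF finite_G])
    also have "\<dots> = real (card (carrier G)) * ((cmod amp)\<^sup>2 * (\<Sum>g\<in>carrier G. (cmod (\<psi> (x\<^sub>0, g, z)))\<^sup>2))"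
      by (simp add: norm_mult power_mult_distrib sum_distrib_left)
    finally have le: "(cmod (v z))\<^sup>2 \<le>
        real (card (carrier G)) * ((cmod amp)\<^sup>2 * (\<Sum>g\<in>carrier G. (cmod (\<psi> (x\<^sub>0, g, z)))\<^sup>2))" .
    \<comment> \<open>The factor k of the frame and |G| from Cauchy-Schwarz cancel exactly against
      the squared modulus of \<open>amp\<close>.\<close>
    have "real k * (cmod (v z))\<^sup>2 \<le>
        ((cmod amp)\<^sup>2 * (real k * real (card (carrier G)))) * (\<Sum>g\<in>carrier G. (cmod (\<psi> (x\<^sub>0, g, z)))\<^sup>2)"
      using mult_left_mono[OF le, of "real k"] by (simp add: mult_ac)
    then show "real k * (cmod (v z))\<^sup>2 \<le> (\<Sum>g\<in>carrier G. (cmod (\<psi> (x\<^sub>0, g, z)))\<^sup>2)"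
      unfolding amp_squared by simp
  qed
  also have "\<dots> = (\<Sum>(x', g, z)\<in>S. if x' = x\<^sub>0 then (cmod (\<psi> (x\<^sub>0, g, z)))\<^sup>2 else 0)"
    unfolding S_def using finite_X x\<^sub>0_in by (intro sum_query_basis_fixed_point[symmetric])
  also have "\<dots> \<le> (\<Sum>b\<in>S. (cmod (\<psi> b))\<^sup>2)"
    by (intro sum_mono) auto
  finally show ?thesis .
qed

text \<open>\<open>r\<close> is the contribution of the complement. Its sign is enough both for
  positivity and for a lower bound on success.\<close>

lemma sform_strategy_povm:
  obtains r where "r \<ge> 0"
    "sform S (strategy_povm y) \<psi> \<psi> = of_real (real k / real (card \<A>) *
       (\<Sum>A\<in>{A\<in>\<A>. f A = y}. (cmod (braket S (final_state A) \<psi>))\<^sup>2) + r)"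
proof -
  define r where "r = (if y = f \<one>\<^bsub>K\<^esub> then (\<Sum>b\<in>S. (cmod (\<psi> b))\<^sup>2) -
    real k / real (card \<A>) * (\<Sum>A\<in>\<A>. (cmod (braket S (final_state A) \<psi>))\<^sup>2) else 0)"
  have "sform S (strategy_povm y) \<psi> \<psi> = sform S (frame_op {A\<in>\<A>. f A = y}) \<psi> \<psi> +
    (if y = f \<one>\<^bsub>K\<^esub> then braket S \<psi> \<psi> - sform S (frame_op \<A>) \<psi> \<psi> else 0)"
  proof -
    have "sform S (\<lambda>i j. if i = j then 1 else 0) \<psi> \<psi> = braket S \<psi> \<psi>"
      using finite_S
      by (simp add: sform_eq braket_def if_distrib[of "\<lambda>x. x * _"] if_distrib[of "\<lambda>x. _ * x"] cong: if_cong)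
    then show ?thesis
      by (simp add: sform_eq strategy_povm_def algebra_simps sum.distrib sum_subtractf)
  qed
  then have "sform S (strategy_povm y) \<psi> \<psi> = of_real (real k / real (card \<A>) *
       (\<Sum>A\<in>{A\<in>\<A>. f A = y}. (cmod (braket S (final_state A) \<psi>))\<^sup>2) + r)"
    unfolding sform_frame_op braket_self r_def by simp
  moreover have "r \<ge> 0" using final_states_bessel by (simp add: r_def)
  ultimately show thesis using that by blast
qed

lemma strategy_povm_valid: "is_povm S (f ` \<A>) strategy_povm"
  unfolding is_povm_def
proof (intro conjI ballI)
  show "finite (f ` \<A>)" using finite_A by simp
next
  fix y
  have "sform S (strategy_povm y) \<psi> \<psi> \<in> \<real> \<and> 0 \<le> Re (sform S (strategy_povm y) \<psi> \<psi>)" for \<psi>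
  proof -
    obtain r where "r \<ge> 0" and *: "sform S (strategy_povm y) \<psi> \<psi> = of_real (real k / real (card \<A>) *
       (\<Sum>A\<in>{A\<in>\<A>. f A = y}. (cmod (braket S (final_state A) \<psi>))\<^sup>2) + r)"
      by (rule sform_strategy_povm)
    moreover have "0 \<le> real k / real (card \<A>) *
       (\<Sum>A\<in>{A\<in>\<A>. f A = y}. (cmod (braket S (final_state A) \<psi>))\<^sup>2)"
      by (intro mult_nonneg_nonneg sum_nonneg) simp_all
    ultimately show ?thesis
      unfolding * Re_complex_of_real by (intro conjI Reals_of_real add_nonneg_nonneg)
  qed
  then show "is_positive S (strategy_povm y)" by (simp add: is_positive_def sform_def)
next
  fix i j
  have "f \<one>\<^bsub>K\<^esub> \<in> f ` \<A>" using group_K monoid.one_closed[of K] by (simp add: group_def)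
  then have "(\<Sum>y\<in>f ` \<A>. strategy_povm y i j) =
      (\<Sum>y\<in>f ` \<A>. frame_op {A\<in>\<A>. f A = y} i j) + ((if i = j then 1 else 0) - frame_op \<A> i j)"
    using finite_A by (simp add: strategy_povm_def sum.distrib)
  also have "(\<Sum>y\<in>f ` \<A>. frame_op {A\<in>\<A>. f A = y} i j) = frame_op \<A> i j"
    unfolding frame_op_def sum_distrib_left[symmetric]
    using finite_A by (intro arg_cong2[where f = "(*)"] refl sum.group) auto
  finally show "(\<Sum>y\<in>f ` \<A>. strategy_povm y i j) = (if i = j then 1 else 0)" by simp
qed

lemma strategy_valid: "valid_algorithm X G q strategy"
proof -
  have init: "init strategy = (\<lambda>(y, g, z). if y = x z 0 then amp * cnj (\<xi> z 0 g) else 0)"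
    by (auto simp: strategy_def phased_state_def fun_eq_iff)
  have "(\<Sum>b\<in>S. (cmod (init strategy b))\<^sup>2) = 1"
    unfolding init by (rule amp_norm_sum) (simp_all add: x_in norm_\<xi>)
  then have "is_unit_state S (init strategy)"
    unfolding is_unit_state_def braket_self by simp
  then show ?thesis
    using gate_unitary strategy_povm_valid
    by (simp add: valid_algorithm_def Let_def strategy_def S_def)
qed

text \<open>All branches belong to one class, so a kernel element multiplies each of them by the
  same \<open>e\<^sub>0 B\<close>: a global phase.\<close>

lemma braket_final_state_kernel:
  assumes "A \<in> \<A>" "B \<in> \<B>"
  shows "cmod (braket S (final_state (A \<otimes>\<^bsub>K\<^esub> B)) (final_state A)) = 1"
proof -
  have B: "B \<in> \<A>" using assms B_subset by auto
  have e_mult: "e z (A \<otimes>\<^bsub>K\<^esub> B) = e\<^sub>0 B * e z A" if "z < k" for z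
    using charactersD(2)[of "e z" K A B] e_in[OF that] query_chars_subset assms(1) B
      e\<^sub>0[OF that assms(2)] by (auto simp: e_def mult.commute)
  have "braket S (final_state (A \<otimes>\<^bsub>K\<^esub> B)) (final_state A) =
      (\<Sum>b\<in>S. cnj (e\<^sub>0 B) * (cnj (final_state A b) * final_state A b))"
    unfolding braket_def
    by (intro sum.cong refl) (auto simp: final_state_def S_def query_basis_def e_mult[simplified])
  also have "\<dots> = cnj (e\<^sub>0 B) * braket S (final_state A) (final_state A)"
    by (simp add: braket_def sum_distrib_left)
  also have "braket S (final_state A) (final_state A) = 1"
  proof -
    have "(\<Sum>b\<in>S. (cmod (final_state A b))\<^sup>2) = 1"
      unfolding final_state_def
      by (rule amp_norm_sum) (use x\<^sub>0_in norm_query_char[OF e_in assms(1)] in simp_all)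
    then show ?thesis by (simp only: braket_self of_real_1)
  qed
  finally show ?thesis
    using norm_query_char[OF e_in[OF k_pos] B] e\<^sub>0[OF k_pos assms(2)] by (simp add: e_def)
qed

text \<open>The bound holds for each oracle separately: every one of the |\<B>| oracles in its coset
  contributes overlap 1 with weight k / |\<A>|.\<close>

lemma strategy_success: "real (card \<B>) / real (card \<A>) * real k \<le> success_prob X G \<A> f q strategy"
proof -
  have "real (card \<B>) / real (card \<A>) * real k \<le> output_prob X G q strategy A (f A)" if A: "A \<in> \<A>" for A
  proof -
    obtain r where r: "r \<ge> 0" and s: "sform S (strategy_povm (f A)) (final_state A) (final_state A) =
       of_real (real k / real (card \<A>) *
       (\<Sum>A'\<in>{A'\<in>\<A>. f A' = f A}. (cmod (braket S (final_state A') (final_state A)))\<^sup>2) + r)"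
      by (rule sform_strategy_povm)
    have "(\<Sum>A'\<in>{A'\<in>\<A>. f A' = f A}. (cmod (braket S (final_state A') (final_state A)))\<^sup>2) =
        (\<Sum>B\<in>\<B>. (cmod (braket S (final_state (A \<otimes>\<^bsub>K\<^esub> B)) (final_state A)))\<^sup>2)"
      by (rule sum.reindex_bij_betw[OF bij_mult_kernel[OF A], symmetric])
    also have "\<dots> = (\<Sum>B\<in>\<B>. 1)"
      by (intro sum.cong refl) (simp only: braket_final_state_kernel[OF A] power_one)
    also have "\<dots> = real (card \<B>)" by simp
    finally have "Re (sform S (strategy_povm (f A)) (final_state A) (final_state A)) =
        real (card \<B>) / real (card \<A>) * real k + r"
      unfolding s by (simp add: mult_ac)
    moreover have "output_prob X G q strategy A (f A) =
        Re (sform S (strategy_povm (f A)) (run X G strategy A q) (run X G strategy A q))"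
      using A by (simp add: output_prob_def sform_def S_def Let_def) (simp add: strategy_def)
    moreover have "\<dots> = Re (sform S (strategy_povm (f A)) (final_state A) (final_state A))"
      by (intro arg_cong[where f = Re] sform_cong) (simp_all only: run_strategy_final[OF A])
    ultimately show ?thesis using r by simp
  qed
  then have "(\<Sum>A\<in>\<A>. real (card \<B>) / real (card \<A>) * real k)
      \<le> (\<Sum>A\<in>\<A>. output_prob X G q strategy A (f A))"
    by (rule sum_mono)
  then show ?thesis
    using card_A_pos by (simp add: success_prob_def field_simps)
qed

end

section \<open>Existence of an optimal strategy and the maximum\<close>

context oracle_problem
begin

lemma exists_strategy:
  assumes e\<^sub>0: "e\<^sub>0 \<in> query_chars X G \<A> q"
  shows "\<exists>alg. valid_algorithm X G q alg \<and>
    real (card \<B>) / real (card \<A>) * real (card (query_char_class X G \<A> q \<B> e\<^sub>0))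
    \<le> success_prob X G \<A> f q alg"
proof -
  define C where "C = query_char_class X G \<A> q \<B> e\<^sub>0"
  have C: "C \<subseteq> query_chars X G \<A> q" by (auto simp: C_def query_char_class_def)
  then have "finite C" using finite_query_chars by (rule finite_subset)
  moreover have "C \<noteq> {}" using e\<^sub>0 by (auto simp: C_def query_char_class_def)
  ultimately have pos: "card C > 0" by (simp add: card_gt_0_iff)
  obtain h where h: "bij_betw h {..<card C} C"
    using ex_bij_betw_nat_finite[OF \<open>finite C\<close>] by (auto simp: atLeast0LessThan)
  have "\<exists>x \<xi>. h z = query_char \<A> q x \<xi> \<and> (\<forall>i<q. x i \<in> X) \<and> (\<forall>i<q. \<xi> i \<in> characters G)"
    if "z < card C" for z
    using bij_betwE[OF h] C that unfolding query_chars_def by blast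
  then obtain x \<xi> where x\<xi>: "\<And>z. z < card C \<Longrightarrow> h z = query_char \<A> q (x z) (\<xi> z)"
    "\<And>z i. z < card C \<Longrightarrow> i < q \<Longrightarrow> x z i \<in> X"
    "\<And>z i. z < card C \<Longrightarrow> i < q \<Longrightarrow> \<xi> z i \<in> characters G"
    by metis
  obtain x\<^sub>0 where x\<^sub>0: "x\<^sub>0 \<in> X" using X_nonempty by blast
  \<comment> \<open>Padding from index \<open>q\<close> on supplies the common final position and
    trivial character; the product over \<open>i < q\<close> does not change.\<close>
  define x' where "x' z i = (if i < q then x z i else x\<^sub>0)" for z i
  define \<xi>' where "\<xi>' z i = (if i < q then \<xi> z i else (\<lambda>_. 1))" for z i
  have h': "query_char \<A> q (x' z) (\<xi>' z) = h z" if "z < card C" for z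
    unfolding x\<xi>(1)[OF that] by (simp add: query_char_def x'_def \<xi>'_def)
  interpret query_strategy X G \<A> H f \<B> q "card C" x' \<xi>' x\<^sub>0 e\<^sub>0
  proof unfold_locales
    show "inj_on (\<lambda>z. query_char \<A> q (x' z) (\<xi>' z)) {..<card C}"
      using bij_betw_imp_inj_on[OF h] h' by (simp add: inj_on_def)
    show "query_char \<A> q (x' z) (\<xi>' z) B = e\<^sub>0 B" if "z < card C" "B \<in> \<B>" for z B
      using bij_betwE[OF h] that by (simp add: h' C_def query_char_class_def)
  qed (use pos x\<^sub>0 x\<xi> one_in_characters in \<open>auto simp: x'_def \<xi>'_def\<close>)
  show ?thesis using strategy_valid strategy_success unfolding C_def by blast
qed

lemma max_success_prob:
  "is_max_success_prob X G \<A> f q (real (card \<B>) / real (card \<A>) *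
     real (MAX e\<in>query_chars X G \<A> q. card (query_char_class X G \<A> q \<B> e)))"
proof -
  let ?E = "query_chars X G \<A> q" and ?c = "\<lambda>e. card (query_char_class X G \<A> q \<B> e)"
  have le: "?c e \<le> Max (?c ` ?E)" if "e \<in> ?E" for e
    using that finite_query_chars by (intro Max_ge) auto
  have "Max (?c ` ?E) \<in> ?c ` ?E"
    using finite_query_chars query_chars_nonempty by (intro Max_in) auto
  then obtain e\<^sub>0 where e\<^sub>0: "e\<^sub>0 \<in> ?E" "Max (?c ` ?E) = ?c e\<^sub>0" by blast
  obtain alg where "valid_algorithm X G q alg"
    "real (card \<B>) / real (card \<A>) * real (Max (?c ` ?E)) \<le> success_prob X G \<A> f q alg"
    using exists_strategy[OF e\<^sub>0(1)] unfolding e\<^sub>0(2) by blast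
  \<comment> \<open>The strategy is only known to reach at least this value; the upper bound applied
    to it yields equality.\<close>
  then show ?thesis
    unfolding is_max_success_prob_def using success_prob_le[OF _ le] by (blast intro: antisym)
qed

end

theorem theorem2:
  fixes X :: "'x set" and G :: "('g, 'm) monoid_scheme" and \<A> :: "('x \<Rightarrow> 'g) set"
    and H :: "('h, 'n) monoid_scheme" and f :: "('x \<Rightarrow> 'g) \<Rightarrow> 'h"
    and \<B> :: "('x \<Rightarrow> 'g) set" and q :: nat
  assumes "finite X" and "X \<noteq> {}"
    and "comm_group G" and "finite (carrier G)"
    and "subgroup \<A> (fun_group X G)"
    and "group H" and "f \<in> hom (subgroup_as_group (fun_group X G) \<A>) H"
    and "\<B> = kernel (subgroup_as_group (fun_group X G) \<A>) H f"
  shows "real (order (subgroup_as_group (fun_group X G) \<A> Mod \<B>)) = real (card \<A>) / real (card \<B>) \<and>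
         is_max_success_prob X G \<A> f q
           (1 / real (order (subgroup_as_group (fun_group X G) \<A> Mod \<B>)) *
            real (MAX e\<in>query_chars X G \<A> q. card (query_char_class X G \<A> q \<B> e))) \<and>
         is_max_success_prob X G \<A> f q
           (real (card \<B>) / real (card \<A>) *
            real (MAX e\<in>query_chars X G \<A> q. card (query_char_class X G \<A> q \<B> e)))"
proof -
  interpret oracle_problem X G \<A> H f \<B>
    by (rule oracle_problem.intro) (fact assms)+
  have "1 / real (order (K Mod \<B>)) = real (card \<B>) / real (card \<A>)"
    unfolding order_quotient by simp
  then show ?thesis using order_quotient max_success_prob by simp
qed

end
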